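(* Let $\Omega\subset\mathbb{R}^n$ be a domain and let $h:\Omega\to\mathbb{R}$ be a continuous function. Then $h$ is harmonic in $\Omega$ if and only if $$\frac{1}{|B(a,r)|}\int_{B(a,r)}h(x)\,dx=\frac{1}{|\partial B(a,r)|}\int_{\partial B(a,r)}h(x)\,ds$$ for all balls $B(a,r)$ whose closure is contained in $\Omega$.
   Context: $B(a,r)$ denotes the open ball in $\mathbb{R}^n$ with centre $a$ and radius $r>0$; $|B(a,r)|$ is its $n$-dimensional volume, $|\partial B(a,r)|$ is the surface measure of its boundary sphere, and $ds$ denotes surface measure. It is not assumed a priori that, for fixed $a$, the common value of the two averages is independent of $r$. *)

theory Defs
  imports "HOL-Analysis.Analysis"
begin

text \<open>
  The partial derivative in direction \<open>i\<close>. The total function \<^const>\<open>frechet_derivative\<close> is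
  meaningful only at points of differentiability; \<open>C1_on\<close> and \<open>C2_on\<close> below supply this.
\<close>

definition partial_deriv :: "('a::euclidean_space \<Rightarrow> real) \<Rightarrow> 'a \<Rightarrow> 'a \<Rightarrow> real"
  where "partial_deriv f i x = frechet_derivative f (at x) i"

definition C1_on :: "'a::euclidean_space set \<Rightarrow> ('a \<Rightarrow> real) \<Rightarrow> bool"
  where "C1_on S f \<longleftrightarrow>
    (\<forall>x\<in>S. f differentiable (at x)) \<and> (\<forall>i\<in>Basis. continuous_on S (partial_deriv f i))"

definition C2_on :: "'a::euclidean_space set \<Rightarrow> ('a \<Rightarrow> real) \<Rightarrow> bool"
  where "C2_on S f \<longleftrightarrow> C1_on S f \<and> (\<forall>i\<in>Basis. C1_on S (partial_deriv f i))"

definition laplacian :: "('a::euclidean_space \<Rightarrow> real) \<Rightarrow> 'a \<Rightarrow> real"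
  where "laplacian f x = (\<Sum>i\<in>Basis. partial_deriv (partial_deriv f i) i x)"

definition harmonic_on :: "'a::euclidean_space set \<Rightarrow> ('a \<Rightarrow> real) \<Rightarrow> bool"
  where "harmonic_on S f \<longleftrightarrow> C2_on S f \<and> (\<forall>x\<in>S. laplacian f x = 0)"

definition radial_proj :: "'a::euclidean_space \<Rightarrow> real \<Rightarrow> 'a \<Rightarrow> 'a"
  where "radial_proj a r x = a + r *\<^sub>R sgn (x - a)"

text \<open>
  Surface measure on the sphere of centre \<open>a\<close> and radius \<open>r\<close>, by the usual construction from
  polar coordinates: the cone with apex \<open>a\<close> over a Borel set \<open>A\<close> of the sphere has
  volume \<open>r / n\<close> times the surface area of \<open>A\<close>, where \<open>n\<close> is the dimension of the space.
  That cone consists of the points that \<open>radial_proj a r\<close> sends into \<open>A\<close>; the centre, where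
  the projection is undefined, is removed. See \<open>emeasure_sphere_measure_cone\<close> below.
  For \<open>n = 1\<close> this is counting measure on the two end points.
\<close>

definition sphere_measure :: "'a::euclidean_space \<Rightarrow> real \<Rightarrow> 'a measure"
  where "sphere_measure a r =
    scale_measure (ennreal (real DIM('a) / r))
      (distr (restrict_space lborel (ball a r - {a})) (restrict_space borel (sphere a r))
        (radial_proj a r))"

lemma sets_sphere_measure [simp]:
  "sets (sphere_measure a r) = sets (restrict_space borel (sphere a r))"
  by (simp add: sphere_measure_def)

lemma space_sphere_measure [simp]: "space (sphere_measure a r) = sphere a r"
  by (simp add: sphere_measure_def space_restrict_space space_scale_measure)

lemma radial_proj_in_sphere:
  assumes "0 < r" "x \<noteq> a"
  shows "radial_proj a r x \<in> sphere a r"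
  using assms by (simp add: radial_proj_def dist_norm norm_sgn)

lemma measurable_radial_proj:
  assumes "0 < r"
  shows "radial_proj a r \<in>
    measurable (restrict_space lborel (ball a r - {a})) (restrict_space borel (sphere a r))"
proof (rule measurable_restrict_space2)
  show "radial_proj a r \<in> space (restrict_space lborel (ball a r - {a})) \<rightarrow> sphere a r"
    using radial_proj_in_sphere[OF assms] by (auto simp: space_restrict_space simp del: mem_sphere)
  have "radial_proj a r \<in> borel_measurable borel"
    unfolding radial_proj_def sgn_div_norm by measurable
  then show "radial_proj a r \<in> borel_measurable (restrict_space lborel (ball a r - {a}))"
    by (intro measurable_restrict_space1) simp
qed

lemma emeasure_sphere_measure:
  fixes a :: "'a::euclidean_space"
  assumes "0 < r" "A \<in> sets borel" "A \<subseteq> sphere a r"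
  shows "emeasure (sphere_measure a r) A =
    ennreal (real DIM('a) / r) * emeasure lborel (radial_proj a r -` A \<inter> (ball a r - {a}))"
proof -
  have "A \<in> sets (restrict_space borel (sphere a r))"
    using assms by (subst sets_restrict_space_iff) auto
  then show ?thesis
    using measurable_radial_proj[OF assms(1), of a]
    by (simp add: sphere_measure_def emeasure_distr space_restrict_space
        emeasure_restrict_space)
qed

lemma emeasure_sphere_measure_cone:
  fixes a :: "'a::euclidean_space"
  assumes "0 < r" "A \<in> sets borel" "A \<subseteq> sphere a r"
  shows "emeasure (sphere_measure a r) A = ennreal (real DIM('a) / r) *
    emeasure lborel {a + t *\<^sub>R (x - a) | t x. 0 < t \<and> t < 1 \<and> x \<in> A}"
proof -
  have "radial_proj a r -` A \<inter> (ball a r - {a}) =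
    {a + t *\<^sub>R (x - a) | t x. 0 < t \<and> t < 1 \<and> x \<in> A}" (is "?L = ?R")
  proof (intro equalityI subsetI)
    fix y assume y: "y \<in> ?L"
    then have "y = a + (norm (y - a) / r) *\<^sub>R (radial_proj a r y - a)"
      using assms(1) by (simp add: radial_proj_def sgn_div_norm)
    moreover have "0 < norm (y - a) / r" "norm (y - a) / r < 1"
      using y assms(1) by (auto simp: dist_norm norm_minus_commute)
    ultimately show "y \<in> ?R"
      using y by blast
  next
    fix y assume "y \<in> ?R"
    then obtain t x where y: "y = a + t *\<^sub>R (x - a)" "0 < t" "t < 1" "x \<in> A"
      by blast
    then have n: "norm (x - a) = r"
      using assms(3) by (auto simp: dist_norm norm_minus_commute)
    have "y - a = t *\<^sub>R (x - a)"
      using y by simp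
    then have "radial_proj a r y = a + (r * (inverse (t * r) * t)) *\<^sub>R (x - a)"
      using y(2) n by (simp add: radial_proj_def sgn_div_norm)
    also have "r * (inverse (t * r) * t) = 1"
      using y(2) assms(1) by (simp add: field_simps)
    finally have "radial_proj a r y = x"
      by simp
    then show "y \<in> ?L"
      using y n assms(1) by (auto simp: dist_norm)
  qed
  then show ?thesis
    using emeasure_sphere_measure[OF assms] by simp
qed

lemma measure_sphere_measure_sphere:
  fixes a :: "'a::euclidean_space"
  assumes "0 < r"
  shows "measure (sphere_measure a r) (sphere a r) =
    real DIM('a) * unit_ball_vol (real DIM('a)) * r ^ (DIM('a) - 1)"
proof -
  have "radial_proj a r -` sphere a r \<inter> (ball a r - {a}) = ball a r - {a}"
    using radial_proj_in_sphere[OF assms] by auto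
  moreover have "emeasure lborel (ball a r - {a}) = emeasure lborel (ball a r)"
    by (rule emeasure_Diff_null_set) (auto simp: null_sets_def)
  ultimately have "emeasure (sphere_measure a r) (sphere a r) =
      ennreal (real DIM('a) / r) * emeasure lborel (ball a r)"
    using emeasure_sphere_measure[OF assms, of "sphere a r" a] by simp
  then have "measure (sphere_measure a r) (sphere a r) =
      real DIM('a) / r * measure lborel (ball a r)"
    using assms by (simp add: measure_def enn2real_mult)
  also have "\<dots> = real DIM('a) / r * (unit_ball_vol (real DIM('a)) * r ^ DIM('a))"
    using content_ball[of r a] assms by simp
  also have "r ^ DIM('a) = r * r ^ (DIM('a) - 1)"
    by (metis DIM_positive power_eq_if not_gr_zero)
  finally show ?thesis
    using assms by simp
qed

definition ball_average :: "('a::euclidean_space \<Rightarrow> real) \<Rightarrow> 'a \<Rightarrow> real \<Rightarrow> real"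
  where "ball_average h a r =
    1 / measure lborel (ball a r) * (LINT x:ball a r|lborel. h x)"

definition sphere_average :: "('a::euclidean_space \<Rightarrow> real) \<Rightarrow> 'a \<Rightarrow> real \<Rightarrow> real"
  where "sphere_average h a r =
    1 / measure (sphere_measure a r) (sphere a r) * (LINT x|sphere_measure a r. h x)"

end

theory Submission
  imports Defs
begin

text \<open>
  For a twice continuously differentiable \<open>h\<close> everything follows from one identity: the integral over
  \<open>ball a r\<close> of the Laplacian of \<open>h\<close>, weighted with \<open>r\<^sup>2 - |x - a|\<^sup>2\<close>, is a positive
  constant (depending on \<open>n\<close> and \<open>r\<close>) times the sphere average minus the ball average of
  \<open>h\<close> (\<open>integral_laplacian_ball\<close>). So a harmonic function has equal averages; and if the
  averages agree on all balls, then letting the ball shrink to a point shows that the Laplacian vanishes there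
  (\<open>C2_averages_eq_imp_laplacian_zero\<close>).

  It remains to see that a continuous \<open>h\<close> with equal averages is twice continuously differentiable. The
  derivative in \<open>r\<close> of the integral of \<open>h\<close> over \<open>ball a r\<close> is the surface integral
  (\<open>has_real_derivative_integral_ball\<close>), so equality of the averages is a differential equation in
  \<open>r\<close> for the ball integral. It makes the ball average constant in \<open>r\<close>, and by continuity the
  constant is \<open>h a\<close> (\<open>spherical_integral_eq_center\<close>). From this mean value property on spheres,
  integrals of \<open>h\<close> against any radial weight reduce to \<open>h a\<close>
  (\<open>integral_radial_weight\<close>). Thus \<open>h\<close> is, up to a constant, its own convolution with a compactly
  supported radial kernel that is twice continuously differentiable (\<open>mean_value_imp_C2\<close>).

  The role of polar coordinates is played by the scaling behaviour of radial extensions of functions on the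
  sphere (\<open>integral_radial_extension\<close>). The role of the divergence theorem is
  played by the translation invariance of Lebesgue measure, applied to functions that vanish on the boundary of
  the ball (\<open>integral_by_parts_ball\<close>).
\<close>

section \<open>Integrals over balls and spheres\<close>

lemma set_integrable_ball:
  fixes f :: "'a::euclidean_space \<Rightarrow> real"
  assumes "continuous_on (cball a R) f" "s \<le> R"
  shows "set_integrable lborel (ball a s) f"
proof (rule set_integrable_subset)
  show "set_integrable lborel (cball a R) f"
    unfolding set_integrable_def using assms(1) by (intro borel_integrable_compact) auto
qed (use assms(2) in auto)

lemma integral_ball_const:
  fixes a :: "'a::euclidean_space"
  assumes "0 \<le> s"
  shows "(LINT x:ball a s|lborel. c) = c * (unit_ball_vol (real DIM('a)) * s ^ DIM('a))"
  using assms content_ball[of s a] by (simp add: set_lebesgue_integral_def)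

lemma integral_ball_bound:
  fixes f :: "'a::euclidean_space \<Rightarrow> real"
  assumes "continuous_on (cball a R) f" "0 \<le> s" "s \<le> R" "\<And>x. x \<in> ball a s \<Longrightarrow> \<bar>f x\<bar> \<le> M"
  shows "\<bar>LINT x:ball a s|lborel. f x\<bar> \<le> M * (unit_ball_vol (real DIM('a)) * s ^ DIM('a))"
proof -
  have "norm (LINT x:ball a s|lborel. f x) \<le> (LINT x:ball a s|lborel. M)"
    unfolding set_lebesgue_integral_def
  proof (rule Bochner_Integration.integral_norm_bound_integral)
    show "integrable lborel (\<lambda>x. indicator (ball a s) x *\<^sub>R f x)"
      using set_integrable_ball[OF assms(1,3)] by (simp add: set_integrable_def)
    show "integrable lborel (\<lambda>x. indicator (ball a s) x *\<^sub>R M)"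
      using set_integrable_ball[of a s "\<lambda>_. M" s] by (simp add: set_integrable_def)
  qed (use assms(4) in \<open>auto simp: indicator_def\<close>)
  then show ?thesis using integral_ball_const[OF assms(2), of a M] by simp
qed

lemma integral_ball_pos:
  fixes f :: "'a::euclidean_space \<Rightarrow> real"
  assumes "0 < r" "continuous_on (cball a r) f" "\<And>x. x \<in> ball a r \<Longrightarrow> 0 < f x"
  shows "0 < (LINT x:ball a r|lborel. f x)"
proof -
  let ?g = "\<lambda>x. indicator (ball a r) x *\<^sub>R f x"
  have i: "integrable lborel ?g"
    using set_integrable_ball[OF assms(2) order_refl] by (simp add: set_integrable_def)
  have nn: "AE x in lborel. 0 \<le> ?g x"
    using assms(3) by (auto simp: indicator_def less_imp_le)
  have "(\<integral>x. ?g x \<partial>lborel) \<noteq> 0"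
  proof
    assume "(\<integral>x. ?g x \<partial>lborel) = 0"
    then have "AE x in lborel. ?g x = 0"
      using integral_nonneg_eq_0_iff_AE[OF i nn] by simp
    then have "AE x in lborel. x \<notin> ball a r"
      by eventually_elim (use assms(3) in \<open>fastforce simp: indicator_def split: if_splits\<close>)
    then have "emeasure lborel (ball a r) = 0"
      by (subst (asm) AE_iff_null_sets[symmetric]) (auto dest: null_setsD1)
    then have "measure lborel (ball a r) = 0" by (simp add: measure_def)
    then show False using assms(1) by simp
  qed
  moreover have "0 \<le> (\<integral>x. ?g x \<partial>lborel)"
    by (rule integral_nonneg_AE[OF nn])
  ultimately show ?thesis by (simp add: set_lebesgue_integral_def)
qed

lemma continuous_on_cball_bounded:
  fixes f :: "'a::euclidean_space \<Rightarrow> real"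
  assumes "continuous_on (cball a r) f"
  obtains M where "0 \<le> M" "\<And>x. x \<in> cball a r \<Longrightarrow> \<bar>f x\<bar> \<le> M"
proof -
  have "bounded (f ` cball a r)"
    using assms by (intro compact_imp_bounded compact_continuous_image) auto
  then obtain M where "\<And>x. x \<in> cball a r \<Longrightarrow> \<bar>f x\<bar> \<le> M"
    unfolding bounded_iff real_norm_def by blast
  then show ?thesis
    by (intro that[of "max 0 M"]) (auto simp: le_max_iff_disj)
qed

lemma set_integral_ball_scale:
  fixes f :: "'a::euclidean_space \<Rightarrow> real"
  assumes "0 < s" "set_integrable lborel (ball a s) f"
  shows "(LINT x:ball a s|lborel. f x) =
    s ^ DIM('a) * (LINT u:ball 0 1|lborel. f (a + s *\<^sub>R u))"
proof -
  let ?g = "\<lambda>x. indicator (ball a s) x *\<^sub>R f x"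
  have g: "?g \<in> borel_measurable borel"
    using assms(2) by (auto simp: set_integrable_def dest: borel_measurable_integrable)
  have pw: "(0::real) \<le> s ^ DIM('a)" using assms(1) by simp
  have "(LINT x:ball a s|lborel. f x) = (\<integral>x. ?g x \<partial>lborel)"
    by (simp add: set_lebesgue_integral_def)
  also have "\<dots> = (\<integral>x. ?g x \<partial>density (distr lborel borel (\<lambda>x. a + s *\<^sub>R x))
      (\<lambda>_. ennreal (s ^ DIM('a))))"
    using assms(1) by (subst lborel_affine[of s a]) (auto simp: ennreal_power)
  also have "\<dots> = (\<integral>x. s ^ DIM('a) * ?g x \<partial>distr lborel borel (\<lambda>x. a + s *\<^sub>R x))"
    using g pw by (subst integral_density) auto
  also have "\<dots> = (\<integral>u. s ^ DIM('a) * ?g (a + s *\<^sub>R u) \<partial>lborel)"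
    using g by (subst integral_distr) auto
  also have "(\<lambda>u. s ^ DIM('a) * ?g (a + s *\<^sub>R u)) =
      (\<lambda>u. s ^ DIM('a) * (indicator (ball 0 1) u *\<^sub>R f (a + s *\<^sub>R u)))"
    using assms(1) by (auto simp: fun_eq_iff indicator_def dist_norm)
  finally show ?thesis by (simp add: set_lebesgue_integral_def)
qed

text \<open>
  Integrating the degree-zero extension of \<open>f\<close> over the solid unit ball replaces surface measure by
  Lebesgue measure: by the cone description of \<open>sphere_measure\<close>, dividing by the volume of the unit
  ball gives the average of \<open>f\<close> over the sphere. The domain of integration then no longer depends on
  \<open>a\<close> and \<open>r\<close>.
\<close>

definition spherical_integral :: "('a::euclidean_space \<Rightarrow> real) \<Rightarrow> 'a \<Rightarrow> real \<Rightarrow> real"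
  where "spherical_integral f a r = (LINT u:ball 0 1|lborel. f (a + r *\<^sub>R sgn u))"

text \<open>
  Since \<open>f\<close> is only known to be continuous on the sphere, the extension is measurable as the
  composition of the Borel function that vanishes off the sphere with the radial projection; the centre is
  cut out because \<open>sgn 0 = 0\<close> sends it to \<open>a\<close>, off the sphere.
\<close>

lemma radial_extension_measurable:
  fixes f :: "'a::euclidean_space \<Rightarrow> real"
  assumes "continuous_on (sphere a r) f" "0 < r"
  shows "(\<lambda>x. indicator (UNIV - {a}) x *\<^sub>R f (a + r *\<^sub>R sgn (x - a))) \<in> borel_measurable borel"
proof -
  let ?g = "\<lambda>x. indicator (sphere a r) x *\<^sub>R f x"
  have g[measurable]: "?g \<in> borel_measurable borel"
    by (rule borel_measurable_continuous_on_indicator) (use assms in auto)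
  have "(\<lambda>x. indicator (UNIV - {a}) x *\<^sub>R ?g (a + r *\<^sub>R (inverse (norm (x - a)) *\<^sub>R (x - a))))
    \<in> borel_measurable borel"
    by measurable
  also have "(\<lambda>x. indicator (UNIV - {a}) x *\<^sub>R ?g (a + r *\<^sub>R (inverse (norm (x - a)) *\<^sub>R (x - a))))
     = (\<lambda>x. indicator (UNIV - {a}) x *\<^sub>R f (a + r *\<^sub>R sgn (x - a)))"
    using assms(2) by (auto simp: fun_eq_iff indicator_def dist_norm sgn_div_norm)
  finally show ?thesis .
qed

lemma set_integrable_radial_extension:
  fixes f :: "'a::euclidean_space \<Rightarrow> real"
  assumes "continuous_on (sphere a r) f" "0 < r"
  shows "set_integrable lborel (ball a s) (\<lambda>x. f (a + r *\<^sub>R sgn (x - a)))"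
proof -
  have "bounded (f ` sphere a r)"
    using assms by (intro compact_imp_bounded compact_continuous_image) auto
  then obtain M where M: "\<And>x. x \<in> sphere a r \<Longrightarrow> \<bar>f x\<bar> \<le> M"
    unfolding bounded_iff real_norm_def by blast
  have a: "AE x in lborel. x \<noteq> a" by (rule AE_lborel_singleton)
  have sph: "x \<noteq> a \<Longrightarrow> a + r *\<^sub>R sgn (x - a) \<in> sphere a r" for x
    using assms(2) by (simp add: dist_norm norm_sgn)
  have m: "(\<lambda>x. indicator (ball a s) x *\<^sub>R (indicator (UNIV - {a}) x *\<^sub>R f (a + r *\<^sub>R sgn (x - a))
     + indicator {a} x *\<^sub>R f a)) \<in> borel_measurable borel"
    by (rule borel_measurable_scaleR[OF _ borel_measurable_add[OF radial_extension_measurable[OF assms]]])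
       (auto intro!: borel_measurable_scaleR borel_measurable_indicator)
  also have "(\<lambda>x. indicator (ball a s) x *\<^sub>R (indicator (UNIV - {a}) x *\<^sub>R f (a + r *\<^sub>R sgn (x - a))
     + indicator {a} x *\<^sub>R f a)) = (\<lambda>x. indicator (ball a s) x *\<^sub>R f (a + r *\<^sub>R sgn (x - a)))"
    by (auto simp: fun_eq_iff indicator_def)
  finally show ?thesis
    unfolding set_integrable_def
    by (intro integrableI_bounded_set[of "ball a s" _ _ M])
       (use a M sph emeasure_bounded_finite[OF bounded_ball, of a s] in
         \<open>auto simp: indicator_def elim!: eventually_mono\<close>)
qed

text \<open>
  The radial extension is invariant under dilations about \<open>a\<close>, so its integral over a ball depends on
  the radius only through the volume. Differences of this formula give its integral over a shell; this is the
  form in which polar coordinates enter the proof.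
\<close>

lemma integral_radial_extension:
  fixes f :: "'a::euclidean_space \<Rightarrow> real"
  assumes "continuous_on (sphere a r) f" "0 < r" "0 < s"
  shows "(LINT x:ball a s|lborel. f (a + r *\<^sub>R sgn (x - a))) =
    s ^ DIM('a) * spherical_integral f a r"
  using set_integral_ball_scale[OF assms(3) set_integrable_radial_extension[OF assms(1,2)]] assms(3)
  by (simp add: spherical_integral_def sgn_scaleR)

lemma set_integrable_spherical:
  fixes f :: "'a::euclidean_space \<Rightarrow> real"
  assumes "continuous_on (sphere a r) f" "0 < r"
  shows "set_integrable lborel (ball 0 1) (\<lambda>u. f (a + r *\<^sub>R sgn u))"
proof -
  have "continuous_on (sphere 0 r) (\<lambda>x. f (a + x))"
    by (rule continuous_on_compose2[OF assms(1)]) (auto intro!: continuous_intros simp: dist_norm)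
  from set_integrable_radial_extension[OF this assms(2), of 1] show ?thesis by simp
qed

lemma spherical_integral_diff_const:
  fixes h :: "'a::euclidean_space \<Rightarrow> real"
  assumes "continuous_on (sphere a r) h" "0 < r"
  shows "spherical_integral (\<lambda>x. h x - c) a r =
    spherical_integral h a r - unit_ball_vol (real DIM('a)) * c"
proof -
  have "spherical_integral (\<lambda>x. h x - c) a r =
      spherical_integral h a r - (LINT u:ball (0::'a) 1|lborel. c)"
    unfolding spherical_integral_def
    by (intro set_integral_diff set_integrable_spherical assms set_integrable_ball[of 0 1]) auto
  then show ?thesis using integral_ball_const[of 1 "0::'a" c] by simp
qed

text \<open>
  The factor \<open>n / r\<close> of the surface measure and the power \<open>r ^ n\<close> from
  \<open>integral_radial_extension\<close> cancel against the total surface measure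
  \<open>n w r ^ (n - 1)\<close> of the sphere, where \<open>w\<close> is the volume of the unit ball.
\<close>

lemma sphere_average_eq:
  fixes h :: "'a::euclidean_space \<Rightarrow> real"
  assumes "continuous_on (sphere a r) h" "0 < r"
  shows "sphere_average h a r = spherical_integral h a r / unit_ball_vol (real DIM('a))"
proof -
  let ?B = "ball a r - {a}" and ?S = "restrict_space borel (sphere a r)"
  let ?D = "distr (restrict_space lborel ?B) ?S (radial_proj a r)"
  define c where "c = real DIM('a) / r"
  have c: "0 < c" using assms(2) by (simp add: c_def)
  have hm: "h \<in> borel_measurable ?S"
    by (rule borel_measurable_continuous_on_restrict) (rule assms)
  have "sphere_measure a r = density ?D (\<lambda>_. ennreal c)"
  proof (rule measure_eqI)
    fix A assume "A \<in> sets (sphere_measure a r)"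
    then have "A \<in> sets ?D" by simp
    then show "emeasure (sphere_measure a r) A = emeasure (density ?D (\<lambda>_. ennreal c)) A"
      by (simp add: sphere_measure_def c_def emeasure_density nn_integral_cmult_indicator)
  qed simp
  then have "(LINT x|sphere_measure a r. h x) = (\<integral>x. c *\<^sub>R h x \<partial>?D)"
    using c hm by (simp add: integral_density)
  also have "\<dots> = (\<integral>x. c *\<^sub>R h (radial_proj a r x) \<partial>restrict_space lborel ?B)"
    by (rule integral_distr) (use measurable_radial_proj[OF assms(2)] hm in auto)
  also have "\<dots> = (\<integral>x. indicator ?B x *\<^sub>R (c *\<^sub>R h (radial_proj a r x)) \<partial>lborel)"
    by (rule integral_restrict_space) auto
  also have "\<dots> = (\<integral>x. c * (indicator (ball a r) x *\<^sub>R h (a + r *\<^sub>R sgn (x - a))) \<partial>lborel)"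
  proof (rule integral_cong_AE)
    have "(\<lambda>x. (c * indicator (ball a r) x) *\<^sub>R
        (indicator (UNIV - {a}) x *\<^sub>R h (a + r *\<^sub>R sgn (x - a)))) \<in> borel_measurable borel"
      by (rule borel_measurable_scaleR[OF _ radial_extension_measurable[OF assms]])
        (intro borel_measurable_times borel_measurable_const borel_measurable_indicator borel_open open_ball)
    also have "(\<lambda>x. (c * indicator (ball a r) x) *\<^sub>R
        (indicator (UNIV - {a}) x *\<^sub>R h (a + r *\<^sub>R sgn (x - a)))) =
        (\<lambda>x. indicator ?B x *\<^sub>R (c *\<^sub>R h (radial_proj a r x)))"
      by (auto simp: fun_eq_iff radial_proj_def indicator_def)
    finally show "(\<lambda>x. indicator ?B x *\<^sub>R (c *\<^sub>R h (radial_proj a r x))) \<in> borel_measurable lborel"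
      by simp
    show "(\<lambda>x. c * (indicator (ball a r) x *\<^sub>R h (a + r *\<^sub>R sgn (x - a)))) \<in> borel_measurable lborel"
      using set_integrable_radial_extension[OF assms, of r]
      unfolding set_integrable_def by (intro borel_measurable_times) (auto dest: borel_measurable_integrable)
    have "AE x in lborel. x \<noteq> a" by (rule AE_lborel_singleton)
    then show "AE x in lborel. indicator ?B x *\<^sub>R (c *\<^sub>R h (radial_proj a r x)) =
        c * (indicator (ball a r) x *\<^sub>R h (a + r *\<^sub>R sgn (x - a)))"
      by eventually_elim (auto simp: radial_proj_def indicator_def)
  qed
  also have "\<dots> = c * (LINT x:ball a r|lborel. h (a + r *\<^sub>R sgn (x - a)))"
    by (simp add: set_lebesgue_integral_def)
  also have "\<dots> = c * r ^ DIM('a) * spherical_integral h a r"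
    using integral_radial_extension[OF assms assms(2)] by simp
  finally have *: "(LINT x|sphere_measure a r. h x) = c * r ^ DIM('a) * spherical_integral h a r" .
  have "r ^ DIM('a) = r * r ^ (DIM('a) - 1)"
    by (metis DIM_positive power_eq_if not_gr_zero)
  then show ?thesis
    unfolding sphere_average_def * measure_sphere_measure_sphere[OF assms(2)]
    using assms(2) by (simp add: c_def)
qed

lemma ball_average_eq:
  fixes h :: "'a::euclidean_space \<Rightarrow> real"
  assumes "0 < r"
  shows "ball_average h a r =
    (LINT x:ball a r|lborel. h x) / (unit_ball_vol (real DIM('a)) * r ^ DIM('a))"
  using assms content_ball[of r a] by (simp add: ball_average_def)

lemma ball_average_eq_sphere_average_iff:
  fixes h :: "'a::euclidean_space \<Rightarrow> real"
  assumes "0 < r" "continuous_on (cball a r) h"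
  shows "ball_average h a r = sphere_average h a r \<longleftrightarrow>
    (LINT x:ball a r|lborel. h x) = r ^ DIM('a) * spherical_integral h a r"
proof -
  have "continuous_on (sphere a r) h" by (rule continuous_on_subset[OF assms(2)]) auto
  then show ?thesis
    using assms(1) unit_ball_vol_pos[of "real DIM('a)"]
    by (simp add: ball_average_eq sphere_average_eq field_simps del: unit_ball_vol_pos)
qed

text \<open>
  The derivative of a ball integral in the radius is the surface integral. Split \<open>f\<close> into its radial
  extension from the sphere of radius \<open>r\<close>, whose ball integrals are a constant times
  \<open>s ^ n\<close>, and the remainder \<open>d\<close>. Between the spheres of radii \<open>r\<close> and \<open>s\<close>
  the remainder is uniformly small by uniform continuity of \<open>f\<close>, so its contribution \<open>E\<close> is
  \<open>o(s - r)\<close>.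
\<close>

lemma has_real_derivative_integral_ball:
  fixes f :: "'a::euclidean_space \<Rightarrow> real"
  assumes f: "continuous_on (cball a R) f" and r: "0 < r" "r < R"
  shows "((\<lambda>s. LINT x:ball a s|lborel. f x) has_real_derivative
    real DIM('a) * r ^ (DIM('a) - 1) * spherical_integral f a r) (at r)"
proof -
  let ?n = "DIM('a)"
  define w where "w = unit_ball_vol (real ?n)"
  have w: "w > 0" by (simp add: w_def)
  have fs: "continuous_on (sphere a r) f"
    by (rule continuous_on_subset[OF f]) (use r in auto)
  define W where "W = spherical_integral f a r"
  define d where "d x = f x - f (a + r *\<^sub>R sgn (x - a))" for x
  define E where "E s = (LINT x:ball a s|lborel. d x)" for s
  have ind: "set_integrable lborel (ball a s) d" if "s \<le> R" for s
    unfolding d_def using f that fs r(1)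
    by (intro set_integral_diff set_integrable_ball set_integrable_radial_extension) auto
  have I: "(LINT x:ball a s|lborel. f x) = s ^ ?n * W + E s" if "0 < s" "s \<le> R" for s
    unfolding E_def d_def W_def using f that fs r(1)
    by (subst set_integral_diff)
       (auto simp: integral_radial_extension intro!: set_integrable_ball set_integrable_radial_extension)
  have uc: "uniformly_continuous_on (cball a R) f"
    using f by (intro compact_uniformly_continuous) auto
  have small: "\<exists>\<delta>>0. \<forall>s. 0 < s \<and> s < R \<and> \<bar>s - r\<bar> < \<delta> \<longrightarrow> \<bar>E s - E r\<bar> \<le> \<epsilon> * w * \<bar>s ^ ?n - r ^ ?n\<bar>"
    if "0 < \<epsilon>" for \<epsilon>
  proof -
    from uc that obtain \<delta> where \<delta>: "0 < \<delta>"
      "\<And>x y. x \<in> cball a R \<Longrightarrow> y \<in> cball a R \<Longrightarrow> dist y x < \<delta> \<Longrightarrow> dist (f y) (f x) < \<epsilon>"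
      unfolding uniformly_continuous_on_def by metis
    show ?thesis
    proof (intro exI[of _ \<delta>] conjI allI impI \<delta>(1))
      fix s assume s: "0 < s \<and> s < R \<and> \<bar>s - r\<bar> < \<delta>"
      \<comment> \<open>Up to the sign \<open>\<sigma>\<close>, \<open>?i\<close> is the indicator of the shell between the two spheres.\<close>
      let ?i = "\<lambda>x. indicator (ball a s) x - indicator (ball a r) x :: real"
      define \<sigma> :: real where "\<sigma> = (if r \<le> s then 1 else -1)"
      have i: "\<bar>?i x\<bar> = \<sigma> * ?i x" for x
        by (auto simp: \<sigma>_def indicator_def)
      have ib: "integrable lborel (indicator (ball a t) :: _ \<Rightarrow> real)" for t
        using emeasure_bounded_finite[OF bounded_ball, of a t] by (intro integrable_real_indicator) auto
      have id: "integrable lborel (\<lambda>x. indicator (ball a t) x * d x)" if "t \<le> R" for t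
        using ind[OF that] by (simp add: set_integrable_def)
      have "\<bar>d x\<bar> \<le> \<epsilon>" if "?i x \<noteq> 0" for x
      proof -
        from that have x: "r \<le> norm (x - a) \<and> norm (x - a) < s \<or> s \<le> norm (x - a) \<and> norm (x - a) < r"
          by (auto simp: indicator_def dist_norm norm_minus_commute split: if_splits)
        then have x0: "x \<noteq> a" using r s by auto
        have "x - a = norm (x - a) *\<^sub>R sgn (x - a)"
          using x0 by (simp add: sgn_div_norm)
        then have "x - (a + r *\<^sub>R sgn (x - a)) = (norm (x - a) - r) *\<^sub>R sgn (x - a)"
          by (simp add: algebra_simps)
        then have "norm (x - (a + r *\<^sub>R sgn (x - a))) = \<bar>norm (x - a) - r\<bar>"
          using x0 by (simp add: norm_sgn)
        also have "\<dots> < \<delta>" using x s by auto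
        finally have "dist (f x) (f (a + r *\<^sub>R sgn (x - a))) < \<epsilon>"
          using x0 r s x by (intro \<delta>(2)) (auto simp: dist_norm norm_sgn norm_minus_commute)
        then show ?thesis by (simp add: d_def dist_real_def)
      qed
      then have le: "norm (?i x * d x) \<le> \<epsilon> * (\<sigma> * ?i x)" for x
        using i[of x] that
        by (cases "?i x = 0") (auto simp: abs_mult mult.commute[of \<epsilon>] intro!: mult_left_mono)
      have "E s - E r = (\<integral>x. ?i x * d x \<partial>lborel)"
        using id[of s] id[of r] s r
        by (simp add: E_def set_lebesgue_integral_def left_diff_distrib)
      also have "\<bar>\<dots>\<bar> \<le> (\<integral>x. \<epsilon> * (\<sigma> * ?i x) \<partial>lborel)"
        unfolding real_norm_def[symmetric]
      proof (rule Bochner_Integration.integral_norm_bound_integral)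
        show "integrable lborel (\<lambda>x. ?i x * d x)"
          using id[of s] id[of r] s r by (simp add: left_diff_distrib)
        show "integrable lborel (\<lambda>x. \<epsilon> * (\<sigma> * ?i x))"
          using ib by (intro integrable_mult_right Bochner_Integration.integrable_diff) auto
      qed (use le in auto)
      also have "\<dots> = \<epsilon> * (\<sigma> * (w * s ^ ?n - w * r ^ ?n))"
        using ib s r content_ball[of s a] content_ball[of r a] by (simp add: w_def)
      also have "\<sigma> * (w * s ^ ?n - w * r ^ ?n) = w * \<bar>s ^ ?n - r ^ ?n\<bar>"
      proof (cases "r \<le> s")
        case True
        then have "r ^ ?n \<le> s ^ ?n" using r by (intro power_mono) auto
        then show ?thesis using True by (simp add: \<sigma>_def right_diff_distrib)
      next
        case False
        then have "s ^ ?n \<le> r ^ ?n" using s by (intro power_mono) auto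
        then show ?thesis using False by (simp add: \<sigma>_def right_diff_distrib abs_if)
      qed
      finally show "\<bar>E s - E r\<bar> \<le> \<epsilon> * w * \<bar>s ^ ?n - r ^ ?n\<bar>" by simp
    qed
  qed
  have pd: "((\<lambda>s. s ^ ?n) has_real_derivative real ?n * r ^ (?n - 1)) (at r)"
    by (auto intro!: derivative_eq_intros)
  have "(E has_real_derivative 0) (at r)"
    unfolding has_field_derivative_iff
  proof (rule tendstoI)
    fix e :: real assume e: "0 < e"
    \<comment> \<open>Near \<open>r\<close>, \<open>C\<close> bounds the difference quotients of \<open>s ^ n\<close>.\<close>
    define C where "C = real ?n * r ^ (?n - 1) + 1"
    have nn: "0 \<le> real ?n * r ^ (?n - 1)" using r by simp
    then have C: "C > 0" by (simp add: C_def)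
    define \<epsilon> where "\<epsilon> = e / (2 * w * C)"
    have \<epsilon>: "\<epsilon> > 0" using e w C by (simp add: \<epsilon>_def)
    from small[OF \<epsilon>] obtain \<delta> where \<delta>: "\<delta> > 0"
      "\<And>s. 0 < s \<Longrightarrow> s < R \<Longrightarrow> \<bar>s - r\<bar> < \<delta> \<Longrightarrow> \<bar>E s - E r\<bar> \<le> \<epsilon> * w * \<bar>s ^ ?n - r ^ ?n\<bar>"
      by blast
    have ev1: "\<forall>\<^sub>F s in at r. \<bar>s - r\<bar> < \<delta>"
      using \<delta>(1) by (auto simp: eventually_at dist_real_def)
    have ev2: "\<forall>\<^sub>F s in at r. s \<in> {0<..<R}"
      using r by (intro eventually_at_in_open') auto
    have ev3: "\<forall>\<^sub>F s in at r. dist ((s ^ ?n - r ^ ?n) / (s - r)) (real ?n * r ^ (?n - 1)) < 1"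
      using pd unfolding has_field_derivative_iff by (auto dest: tendstoD[where e=1])
    have ev4: "\<forall>\<^sub>F s in at r. s \<noteq> r" by (simp add: eventually_at_filter)
    from ev1 ev2 ev3 ev4 show "\<forall>\<^sub>F s in at r. dist ((E s - E r) / (s - r)) 0 < e"
    proof eventually_elim
      case (elim s)
      have "\<bar>(s ^ ?n - r ^ ?n) / (s - r)\<bar> \<le> C"
        using elim(3) nn unfolding dist_real_def C_def by linarith
      then have c: "\<bar>s ^ ?n - r ^ ?n\<bar> \<le> C * \<bar>s - r\<bar>"
        using elim(4) by (simp add: abs_divide pos_divide_le_eq)
      have "\<bar>E s - E r\<bar> \<le> \<epsilon> * w * \<bar>s ^ ?n - r ^ ?n\<bar>" using \<delta>(2) elim by auto
      also have "\<dots> \<le> \<epsilon> * w * (C * \<bar>s - r\<bar>)"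
        using c \<epsilon> w by (intro mult_left_mono) auto
      also have "\<dots> = (e / 2) * \<bar>s - r\<bar>"
        using w C by (simp add: \<epsilon>_def)
      also have "\<dots> < e * \<bar>s - r\<bar>" using e elim(4) by (intro mult_strict_right_mono) auto
      finally show ?case using elim(4) by (simp add: abs_divide pos_divide_less_eq)
    qed
  qed
  from DERIV_add[OF DERIV_cmult_right[OF pd, of W] this]
  have "((\<lambda>s. s ^ ?n * W + E s) has_real_derivative real ?n * r ^ (?n - 1) * W) (at r)"
    by simp
  moreover have "\<forall>\<^sub>F s in nhds r. s \<in> {0<..<R}"
    using r by (intro eventually_nhds_in_open) auto
  then have "\<forall>\<^sub>F s in nhds r. (LINT x:ball a s|lborel. f x) = s ^ ?n * W + E s"
    by eventually_elim (use I in auto)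
  ultimately show ?thesis
    by (subst DERIV_cong_ev[OF refl _ refl]) (auto simp: W_def)
qed

section \<open>The Laplacian as the difference of the averages\<close>

lemma C1_on_subset: "C1_on S f \<Longrightarrow> T \<subseteq> S \<Longrightarrow> C1_on T f"
  unfolding C1_on_def by (meson continuous_on_subset subsetD)

lemma C2_on_subset: "C2_on S f \<Longrightarrow> T \<subseteq> S \<Longrightarrow> C2_on T f"
  unfolding C2_on_def by (meson C1_on_subset)

lemma differentiable_has_derivative_partials:
  fixes f :: "'a::euclidean_space \<Rightarrow> real"
  assumes "f differentiable (at x)"
  shows "(f has_derivative (\<lambda>v. \<Sum>i\<in>Basis. (v \<bullet> i) * partial_deriv f i x)) (at x)"
proof -
  have d: "(f has_derivative frechet_derivative f (at x)) (at x)"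
    using assms frechet_derivative_works by blast
  interpret linear "frechet_derivative f (at x)"
    by (rule linear_frechet_derivative[OF assms])
  have "frechet_derivative f (at x) v = (\<Sum>i\<in>Basis. (v \<bullet> i) * partial_deriv f i x)" for v
    by (subst euclidean_representation[symmetric, of v]) (simp add: sum scale partial_deriv_def)
  then show ?thesis using d by (metis (no_types, lifting) ext)
qed

lemma differentiable_directional_derivative:
  fixes f :: "'a::euclidean_space \<Rightarrow> real"
  assumes "f differentiable (at x)"
  shows "((\<lambda>t. f (x + t *\<^sub>R e)) has_real_derivative partial_deriv f e x) (at 0)"
proof -
  have d: "(f has_derivative frechet_derivative f (at x)) (at (x + 0 *\<^sub>R e))"
    using assms frechet_derivative_works by auto
  have "((\<lambda>t. x + t *\<^sub>R e) has_derivative (\<lambda>t. t *\<^sub>R e)) (at (0::real))"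
    by (auto intro!: derivative_eq_intros)
  from has_derivative_compose[OF this d]
  have "((\<lambda>t. f (x + t *\<^sub>R e)) has_derivative (\<lambda>t. frechet_derivative f (at x) (t *\<^sub>R e))) (at 0)" .
  then show ?thesis
    by (rule has_derivative_imp_has_field_derivative)
       (simp add: linear_scale[OF linear_frechet_derivative[OF assms]] partial_deriv_def)
qed

lemma set_lebesgue_integral_sum:
  fixes f :: "'i \<Rightarrow> 'a \<Rightarrow> real"
  assumes "\<And>i. i \<in> I \<Longrightarrow> set_integrable M A (f i)"
  shows "(LINT x:A|M. \<Sum>i\<in>I. f i x) = (\<Sum>i\<in>I. LINT x:A|M. f i x)"
  using assms by (simp add: set_lebesgue_integral_def set_integrable_def sum_distrib_left)

text \<open>
  The difference quotients at \<open>t0\<close> are dominated by \<open>b\<close>. Differentiability almost everywhere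
  suffices, so that functions with a kink along a sphere are covered.
\<close>

lemma has_real_derivative_integral_dominated:
  fixes f :: "real \<Rightarrow> 'a \<Rightarrow> real"
  assumes \<delta>: "0 < \<delta>"
    and int: "\<And>t. \<bar>t - t0\<bar> < \<delta> \<Longrightarrow> integrable M (f t)"
    and b: "integrable M b"
    and bound: "\<And>t x. \<bar>t - t0\<bar> < \<delta> \<Longrightarrow> \<bar>f t x - f t0 x\<bar> \<le> b x * \<bar>t - t0\<bar>"
    and deriv: "AE x in M. ((\<lambda>t. f t x) has_real_derivative g x) (at t0)"
    and g: "g \<in> borel_measurable M"
  shows "((\<lambda>t. \<integral>x. f t x \<partial>M) has_real_derivative (\<integral>x. g x \<partial>M)) (at t0)"
  unfolding has_field_derivative_iff tendsto_at_iff_sequentially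
proof (intro allI impI)
  fix X :: "nat \<Rightarrow> real"
  assume X: "\<forall>i. X i \<in> UNIV - {t0}" "X \<longlonglongrightarrow> t0"
  \<comment> \<open>The domination holds only near \<open>t0\<close>, so the sequence is shifted by \<open>N\<close>.\<close>
  from LIMSEQ_D[OF X(2) \<delta>] obtain N where "\<And>i. N \<le> i \<Longrightarrow> norm (X i - t0) < \<delta>" by blast
  then have N: "\<bar>X (i + N) - t0\<bar> < \<delta>" for i by simp
  let ?Y = "\<lambda>i. X (i + N)"
  have Y0: "?Y i \<noteq> t0" for i using X(1) by auto
  have Y: "?Y \<longlonglongrightarrow> t0" using X(2) by (rule LIMSEQ_ignore_initial_segment)
  have q: "((\<integral>x. f (?Y i) x \<partial>M) - (\<integral>x. f t0 x \<partial>M)) / (?Y i - t0) =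
      (\<integral>x. (f (?Y i) x - f t0 x) / (?Y i - t0) \<partial>M)" for i
    using int[OF N] int[of t0] \<delta> by simp
  have "(\<lambda>i. \<integral>x. (f (?Y i) x - f t0 x) / (?Y i - t0) \<partial>M) \<longlonglongrightarrow> (\<integral>x. g x \<partial>M)"
  proof (rule integral_dominated_convergence[OF g _ b])
    fix i
    show "(\<lambda>x. (f (?Y i) x - f t0 x) / (?Y i - t0)) \<in> borel_measurable M"
      using int[OF N] int[of t0] \<delta>
      by (intro borel_measurable_divide borel_measurable_diff) auto
    show "AE x in M. norm ((f (?Y i) x - f t0 x) / (?Y i - t0)) \<le> b x"
      using bound[OF N] Y0[of i] by (auto simp: abs_divide pos_divide_le_eq)
  next
    show "AE x in M. (\<lambda>i. (f (?Y i) x - f t0 x) / (?Y i - t0)) \<longlonglongrightarrow> g x"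
      using deriv
    proof eventually_elim
      case (elim x)
      then have "((\<lambda>t. (f t x - f t0 x) / (t - t0)) \<longlongrightarrow> g x) (at t0)"
        by (simp add: has_field_derivative_iff)
      then show ?case
        unfolding tendsto_at_iff_sequentially comp_def by (rule allE[of _ ?Y]) (use Y Y0 in simp)
    qed
  qed
  then have "(\<lambda>i. ((\<integral>x. f (?Y i) x \<partial>M) - (\<integral>x. f t0 x \<partial>M)) / (?Y i - t0)) \<longlonglongrightarrow> (\<integral>x. g x \<partial>M)"
    unfolding q .
  then show "((\<lambda>y. ((\<integral>x. f y x \<partial>M) - (\<integral>x. f t0 x \<partial>M)) / (y - t0)) \<circ> X) \<longlonglongrightarrow> (\<integral>x. g x \<partial>M)"
    unfolding comp_def by (rule LIMSEQ_offset)
qed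

text \<open>
  This is the divergence theorem for the product of \<open>G\<close> with the weight
  \<open>r\<^sup>2 - |x - a|\<^sup>2\<close>. As the weight vanishes on the sphere, the product extended by zero,
  \<open>P\<close>, is Lipschitz along \<open>e\<close> on the whole space, and no boundary term arises: the integral of
  \<open>P\<close> does not change under translations along \<open>e\<close>, and differentiating this constant under
  the integral sign shows that the directional derivative \<open>D\<close> of \<open>P\<close> has integral zero.
\<close>

lemma integral_by_parts_ball:
  fixes G G' :: "'a::euclidean_space \<Rightarrow> real"
  assumes r: "0 < r"
    and G: "continuous_on (cball a r) G" and G': "continuous_on (cball a r) G'"
    and dG: "\<And>x. x \<in> ball a r \<Longrightarrow> ((\<lambda>t. G (x + t *\<^sub>R e)) has_real_derivative G' x) (at 0)"
  shows "(LINT x:ball a r|lborel. (r\<^sup>2 - (norm (x - a))\<^sup>2) * G' x) =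
    2 * (LINT x:ball a r|lborel. ((x - a) \<bullet> e) * G x)"
proof -
  define P where "P x = indicator (ball a r) x * ((r\<^sup>2 - (norm (x - a))\<^sup>2) * G x)" for x
  define D where "D x = (r\<^sup>2 - (norm (x - a))\<^sup>2) * G' x - 2 * (((x - a) \<bullet> e) * G x)" for x
  have contD: "continuous_on (cball a r) D"
    unfolding D_def by (intro continuous_intros G G')
  obtain L where L: "0 \<le> L" "\<And>x. x \<in> cball a r \<Longrightarrow> \<bar>D x\<bar> \<le> L"
    using continuous_on_cball_bounded[OF contD] by blast
  obtain M where M: "0 \<le> M" "\<And>x. x \<in> cball a r \<Longrightarrow> \<bar>G x\<bar> \<le> M"
    using continuous_on_cball_bounded[OF G] by blast
  have shift: "((\<lambda>t. F (x + t *\<^sub>R e)) has_real_derivative c) (at s)"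
    if "((\<lambda>t. F (x + s *\<^sub>R e + t *\<^sub>R e)) has_real_derivative c) (at 0)" for F :: "'a \<Rightarrow> real" and x c s
    using that DERIV_shift[of "\<lambda>t. F (x + t *\<^sub>R e)" c 0 s] by (simp add: algebra_simps)
  have dP0: "((\<lambda>t. (r\<^sup>2 - (norm (x + t *\<^sub>R e - a))\<^sup>2) * G (x + t *\<^sub>R e)) has_real_derivative D x) (at 0)"
    if "x \<in> ball a r" for x
  proof -
    have "((\<lambda>t. r\<^sup>2 - (x - a + t *\<^sub>R e) \<bullet> (x - a + t *\<^sub>R e)) has_real_derivative - (2 * ((x - a) \<bullet> e))) (at 0)"
      by (auto intro!: derivative_eq_intros simp: inner_add_left inner_add_right inner_commute)
    from DERIV_mult[OF this dG[OF that]] show ?thesis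
      by (simp add: D_def power2_norm_eq_inner algebra_simps)
  qed
  have Pin: "P y = (r\<^sup>2 - (norm (y - a))\<^sup>2) * G y" if "y \<in> ball a r" for y
    using that by (simp add: P_def)
  have Pout: "P y = 0" if "y \<notin> ball a r" for y
    using that by (simp add: P_def)
  have dP: "((\<lambda>t. P (x + t *\<^sub>R e)) has_real_derivative indicator (ball a r) x * D x) (at 0)"
    if "x \<notin> sphere a r" for x
  proof -
    have tend: "((\<lambda>t. x + t *\<^sub>R e) \<longlongrightarrow> x + 0 *\<^sub>R e) (nhds (0::real))"
      by (intro tendsto_intros filterlim_ident)
    show ?thesis
    proof (cases "x \<in> ball a r")
      case True
      then have "\<forall>\<^sub>F t in nhds 0. x + t *\<^sub>R e \<in> ball a r"
        using tend by (intro topological_tendstoD) auto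
      then have "\<forall>\<^sub>F t in nhds 0. P (x + t *\<^sub>R e) = (r\<^sup>2 - (norm (x + t *\<^sub>R e - a))\<^sup>2) * G (x + t *\<^sub>R e)"
        by eventually_elim (rule Pin)
      then show ?thesis
        using dP0[OF True] True by (subst DERIV_cong_ev[OF refl _ refl]) auto
    next
      case False
      then have "x \<in> - cball a r" using that by auto
      then have "\<forall>\<^sub>F t in nhds 0. x + t *\<^sub>R e \<in> - cball a r"
        using tend by (intro topological_tendstoD) auto
      then have "\<forall>\<^sub>F t in nhds 0. P (x + t *\<^sub>R e) = 0"
        by eventually_elim (rule Pout, auto)
      then show ?thesis
        using False by (subst DERIV_cong_ev[OF refl _ refl]) auto
    qed
  qed
  define K where "K = L + 2 * r * M * norm e"
  have K: "0 \<le> K" "L \<le> K" "2 * r * M * norm e \<le> K" using L(1) M(1) r by (auto simp: K_def)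
  \<comment> \<open>A step that leaves the ball starts where the weight is at most \<open>2 r\<close> times the step length.\<close>
  have edge: "\<bar>P y\<bar> \<le> K * \<bar>t\<bar>" if "y \<in> ball a r" "y + t *\<^sub>R e \<notin> ball a r" for y t
  proof -
    have y: "norm (y - a) < r" using that(1) by (simp add: dist_norm norm_minus_commute)
    have "r \<le> norm (y - a + t *\<^sub>R e)" using that(2) by (simp add: dist_norm norm_minus_commute algebra_simps)
    also have "\<dots> \<le> norm (y - a) + \<bar>t\<bar> * norm e" by (rule norm_triangle_le) simp
    finally have d: "r - norm (y - a) \<le> \<bar>t\<bar> * norm e" by simp
    have "P y = (r + norm (y - a)) * (r - norm (y - a)) * G y"
      unfolding Pin[OF that(1)] by (simp add: power2_eq_square algebra_simps)
    moreover have "\<bar>r + norm (y - a)\<bar> = r + norm (y - a)" "\<bar>r - norm (y - a)\<bar> = r - norm (y - a)"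
      using y r by simp_all
    ultimately have "\<bar>P y\<bar> = (r + norm (y - a)) * (r - norm (y - a)) * \<bar>G y\<bar>"
      by (simp only: abs_mult)
    also have "\<dots> \<le> (2 * r) * (\<bar>t\<bar> * norm e) * M"
      using y r d M(2)[of y] that(1) M(1) by (intro mult_mono) auto
    also have "\<dots> = (2 * r * M * norm e) * \<bar>t\<bar>" by simp
    also have "\<dots> \<le> K * \<bar>t\<bar>" by (intro mult_right_mono K) simp
    finally show ?thesis .
  qed
  have lip: "\<bar>P (x + t *\<^sub>R e) - P x\<bar> \<le> K * \<bar>t\<bar>" for x t
  proof -
    consider "x \<in> ball a r" "x + t *\<^sub>R e \<in> ball a r" | "x \<in> ball a r" "x + t *\<^sub>R e \<notin> ball a r"
      | "x \<notin> ball a r" "x + t *\<^sub>R e \<in> ball a r" | "x \<notin> ball a r" "x + t *\<^sub>R e \<notin> ball a r" by blast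
    then show ?thesis
    proof cases
      case 1
      have seg: "x + s *\<^sub>R e \<in> ball a r" if s: "s \<in> closed_segment 0 t" for s
      proof -
        from s obtain u where u: "0 \<le> u" "u \<le> 1" "s = u * t"
          by (auto simp: in_segment)
        have "(1 - u) *\<^sub>R x + u *\<^sub>R (x + t *\<^sub>R e) \<in> ball a r"
          using 1 u by (intro convexD[OF convex_ball]) auto
        then show ?thesis by (simp add: u algebra_simps)
      qed
      have "norm (P (x + t *\<^sub>R e) - P (x + 0 *\<^sub>R e)) \<le> L * norm (t - 0)"
      proof (rule field_differentiable_bound[where S="closed_segment 0 t" and f="\<lambda>s. P (x + s *\<^sub>R e)"])
        fix s assume "s \<in> closed_segment 0 t"
        then have b: "x + s *\<^sub>R e \<in> ball a r" by (rule seg)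
        then have "((\<lambda>t. P (x + t *\<^sub>R e)) has_real_derivative indicator (ball a r) (x + s *\<^sub>R e) * D (x + s *\<^sub>R e)) (at s)"
          using shift[of P x s] dP[of "x + s *\<^sub>R e"] by auto
        then show "((\<lambda>t. P (x + t *\<^sub>R e)) has_real_derivative D (x + s *\<^sub>R e)) (at s within closed_segment 0 t)"
          using b by (auto intro: has_field_derivative_at_within)
        show "norm (D (x + s *\<^sub>R e)) \<le> L" using L(2)[of "x + s *\<^sub>R e"] b by auto
      qed auto
      also have "L * norm (t - 0) \<le> K * \<bar>t\<bar>" using K by (auto intro: mult_right_mono)
      finally show ?thesis by simp
    next
      case 2 then show ?thesis using edge[OF 2] by (simp add: Pout)
    next
      case 3
      then show ?thesis using edge[of "x + t *\<^sub>R e" "- t"] by (simp add: Pout)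
    next
      case 4 then show ?thesis using K by (simp add: Pout)
    qed
  qed
  have intP: "integrable lborel P"
  proof -
    have "set_integrable lborel (ball a r) (\<lambda>x. (r\<^sup>2 - (norm (x - a))\<^sup>2) * G x)"
      by (rule set_integrable_ball[of a r]) (auto intro!: continuous_intros G)
    then show ?thesis by (simp add: set_integrable_def P_def[abs_def])
  qed
  have Pmeas: "P \<in> borel_measurable borel" using intP by auto
  have trans: "(\<integral>x. P (x + t *\<^sub>R e) \<partial>lborel) = (\<integral>x. P x \<partial>lborel)"
    "integrable lborel (\<lambda>x. P (x + t *\<^sub>R e))" for t
  proof -
    have "(\<integral>x. P x \<partial>lborel) = (\<integral>x. P x \<partial>distr lborel borel ((+) (t *\<^sub>R e)))"
      by (simp add: lborel_distr_plus)
    also have "\<dots> = (\<integral>x. P (t *\<^sub>R e + x) \<partial>lborel)"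
      using Pmeas by (intro integral_distr) auto
    finally show "(\<integral>x. P (x + t *\<^sub>R e) \<partial>lborel) = (\<integral>x. P x \<partial>lborel)" by (simp add: add.commute)
    have "integrable (distr lborel borel ((+) (t *\<^sub>R e))) P"
      using intP by (simp add: lborel_distr_plus)
    then show "integrable lborel (\<lambda>x. P (x + t *\<^sub>R e))"
      by (subst (asm) integrable_distr_eq) (use Pmeas in \<open>auto simp: add.commute\<close>)
  qed
  have intD: "set_integrable lborel (ball a r) D"
    by (rule set_integrable_ball[OF contD order_refl])
  \<comment> \<open>Steps of length less than \<open>norm e\<close> move the support of \<open>P\<close> only within \<open>?B\<close>.\<close>
  let ?B = "ball a (r + norm e)"
  have "((\<lambda>t. \<integral>x. P (x + t *\<^sub>R e) \<partial>lborel) has_real_derivative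
      (\<integral>x. indicator (ball a r) x * D x \<partial>lborel)) (at 0)"
  proof (rule has_real_derivative_integral_dominated[where \<delta> = 1 and b = "\<lambda>x. K * indicator ?B x"])
    show "integrable lborel (\<lambda>x. K * indicator ?B x)"
      using emeasure_bounded_finite[OF bounded_ball, of a "r + norm e"]
      by (intro integrable_mult_right integrable_real_indicator) auto
    show "\<bar>P (x + t *\<^sub>R e) - P (x + 0 *\<^sub>R e)\<bar> \<le> K * indicator ?B x * \<bar>t - 0\<bar>" if "\<bar>t - 0\<bar> < 1" for t x
    proof (cases "x \<in> ?B")
      case True
      then show ?thesis using lip[of x t] by simp
    next
      case False
      then have x: "r + norm e \<le> norm (x - a)" by (simp add: dist_norm norm_minus_commute)
      have "norm (x - a) \<le> norm (x + t *\<^sub>R e - a) + \<bar>t\<bar> * norm e"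
        using norm_triangle_ineq4[of "x + t *\<^sub>R e - a" "t *\<^sub>R e"] by (simp add: algebra_simps)
      moreover have "\<bar>t\<bar> * norm e \<le> norm e" using that by (intro mult_left_le_one_le) auto
      ultimately have "r \<le> norm (x + t *\<^sub>R e - a)" "r \<le> norm (x - a)"
        using x norm_ge_zero[of e] by linarith+
      then have "x + t *\<^sub>R e \<notin> ball a r" "x \<notin> ball a r"
        by (auto simp: dist_norm norm_minus_commute)
      then show ?thesis using False by (simp add: Pout)
    qed
    \<comment> \<open>\<open>P\<close> may have a kink on the sphere, which is a null set.\<close>
    have "negligible (sphere a r)" by (rule negligible_sphere)
    then have "AE x in lebesgue. x \<notin> sphere a r"
      unfolding negligible_iff_null_sets by (rule AE_not_in)
    then have "AE x in lborel. x \<notin> sphere a r"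
      by (simp add: AE_completion_iff)
    then show "AE x in lborel. ((\<lambda>t. P (x + t *\<^sub>R e)) has_real_derivative indicator (ball a r) x * D x) (at 0)"
      by eventually_elim (rule dP)
    show "(\<lambda>x. indicator (ball a r) x * D x) \<in> borel_measurable lborel"
      using intD by (auto simp: set_integrable_def dest: borel_measurable_integrable)
  qed (use trans in auto)
  then have "((\<lambda>t::real. \<integral>x. P x \<partial>lborel) has_real_derivative (LINT x:ball a r|lborel. D x)) (at 0)"
    unfolding trans(1) by (simp add: set_lebesgue_integral_def)
  then have "(LINT x:ball a r|lborel. D x) = 0"
    by (rule DERIV_unique) (rule DERIV_const)
  moreover have "(LINT x:ball a r|lborel. D x) =
      (LINT x:ball a r|lborel. (r\<^sup>2 - (norm (x - a))\<^sup>2) * G' x) -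
      (LINT x:ball a r|lborel. 2 * (((x - a) \<bullet> e) * G x))"
    unfolding D_def
    by (intro set_integral_diff set_integrable_ball[of a r]) (auto intro!: continuous_intros G G')
  ultimately show ?thesis by simp
qed

lemma has_real_derivative_integral_dilation:
  fixes h :: "'a::euclidean_space \<Rightarrow> real"
  assumes dh: "\<And>x. x \<in> cball a R \<Longrightarrow> (h has_derivative (\<lambda>v. \<Sum>i\<in>Basis. (v \<bullet> i) * p i x)) (at x)"
    and p: "\<And>i. i \<in> Basis \<Longrightarrow> continuous_on (cball a R) (p i)"
    and r: "0 < r" "r < R"
  shows "((\<lambda>s. LINT u:ball 0 1|lborel. h (a + s *\<^sub>R u)) has_real_derivative
    (LINT u:ball 0 1|lborel. \<Sum>i\<in>Basis. (u \<bullet> i) * p i (a + r *\<^sub>R u))) (at r)"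
proof -
  have h: "continuous_on (cball a R) h"
    using dh by (meson continuous_at_imp_continuous_on has_derivative_continuous)
  \<comment> \<open>A common Lipschitz constant for all rays comes from the sum of the partial derivatives in absolute value.\<close>
  have "continuous_on (cball a R) (\<lambda>x. \<Sum>i\<in>Basis. \<bar>p i x\<bar>)"
    by (intro continuous_intros p)
  then obtain M where M: "0 \<le> M" "\<And>x. x \<in> cball a R \<Longrightarrow> \<bar>\<Sum>i\<in>Basis. \<bar>p i x\<bar>\<bar> \<le> M"
    using continuous_on_cball_bounded by blast
  have cb: "a + s *\<^sub>R u \<in> cball a R" if "0 < s" "s < R" "u \<in> cball 0 1" for s u
  proof -
    have "s * norm u \<le> R * 1" using that by (intro mult_mono) auto
    then show ?thesis using that by (simp add: dist_norm)
  qed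
  have int: "set_integrable lborel (ball 0 1) (\<lambda>u. h (a + s *\<^sub>R u))" if "0 < s" "s < R" for s
    using cb[OF that]
    by (intro set_integrable_ball[of 0 1] continuous_on_compose2[OF h]) (auto intro!: continuous_intros)
  have intp: "set_integrable lborel (ball 0 1) (\<lambda>u. \<Sum>i\<in>Basis. (u \<bullet> i) * p i (a + r *\<^sub>R u))"
    using cb[OF r]
    by (intro set_integrable_ball[of 0 1] continuous_intros continuous_on_compose2[OF p]) auto
  have dl: "((\<lambda>s. h (a + s *\<^sub>R u)) has_real_derivative (\<Sum>i\<in>Basis. (u \<bullet> i) * p i (a + s *\<^sub>R u))) (at s)"
    if "0 < s" "s < R" "u \<in> ball 0 1" for s u
  proof -
    have "((\<lambda>s. a + s *\<^sub>R u) has_derivative (\<lambda>t. t *\<^sub>R u)) (at s)"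
      by (auto intro!: derivative_eq_intros)
    from has_derivative_compose[OF this dh[OF cb]] that
    have "((\<lambda>s. h (a + s *\<^sub>R u)) has_derivative (\<lambda>t. \<Sum>i\<in>Basis. ((t *\<^sub>R u) \<bullet> i) * p i (a + s *\<^sub>R u))) (at s)"
      by auto
    then show ?thesis
      by (rule has_derivative_imp_has_field_derivative) (simp add: sum_distrib_left mult_ac)
  qed
  have lip: "\<bar>h (a + s *\<^sub>R u) - h (a + r *\<^sub>R u)\<bar> \<le> M * \<bar>s - r\<bar>"
    if "0 < s" "s < R" "u \<in> ball 0 1" for s u
  proof -
    have "norm (h (a + s *\<^sub>R u) - h (a + r *\<^sub>R u)) \<le> M * norm (s - r)"
    proof (rule field_differentiable_bound[where S="{0<..<R}" and f="\<lambda>s. h (a + s *\<^sub>R u)"])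
      fix t assume t: "t \<in> {0<..<R}"
      show "((\<lambda>s. h (a + s *\<^sub>R u)) has_field_derivative (\<Sum>i\<in>Basis. (u \<bullet> i) * p i (a + t *\<^sub>R u))) (at t within {0<..<R})"
        using dl[of t u] t that by (auto intro: has_field_derivative_at_within)
      have "\<bar>\<Sum>i\<in>Basis. (u \<bullet> i) * p i (a + t *\<^sub>R u)\<bar> \<le> (\<Sum>i\<in>Basis. \<bar>p i (a + t *\<^sub>R u)\<bar>)"
      proof (rule order_trans[OF sum_abs sum_mono])
        fix i :: 'a assume "i \<in> Basis"
        then have "\<bar>u \<bullet> i\<bar> \<le> 1" using Basis_le_norm[of i u] that by auto
        then show "\<bar>(u \<bullet> i) * p i (a + t *\<^sub>R u)\<bar> \<le> \<bar>p i (a + t *\<^sub>R u)\<bar>"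
          unfolding abs_mult by (rule mult_left_le_one_le[rotated 2]) auto
      qed
      also have "\<dots> \<le> M" using M(2)[of "a + t *\<^sub>R u"] cb[of t u] t that by auto
      finally show "norm (\<Sum>i\<in>Basis. (u \<bullet> i) * p i (a + t *\<^sub>R u)) \<le> M" by simp
    qed (use that r in auto)
    then show ?thesis by simp
  qed
  have "((\<lambda>s. \<integral>u. indicator (ball 0 1) u * h (a + s *\<^sub>R u) \<partial>lborel) has_real_derivative
      (\<integral>u. indicator (ball 0 1) u * (\<Sum>i\<in>Basis. (u \<bullet> i) * p i (a + r *\<^sub>R u)) \<partial>lborel)) (at r)"
  proof (rule has_real_derivative_integral_dominated[where \<delta> = "min r (R - r)" and b = "\<lambda>x. M * indicator (ball 0 1) x"])
    show "integrable lborel (\<lambda>x. M * indicator (ball (0::'a) 1) x)"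
      using emeasure_bounded_finite[OF bounded_ball, of "0::'a" 1]
      by (intro integrable_mult_right integrable_real_indicator) auto
    fix t assume "\<bar>t - r\<bar> < min r (R - r)"
    then have t: "0 < t" "t < R" by auto
    show "integrable lborel (\<lambda>u. indicator (ball 0 1) u * h (a + t *\<^sub>R u))"
      using int[OF t] by (simp add: set_integrable_def)
    show "\<bar>indicator (ball 0 1) u * h (a + t *\<^sub>R u) - indicator (ball 0 1) u * h (a + r *\<^sub>R u)\<bar>
        \<le> M * indicator (ball 0 1) u * \<bar>t - r\<bar>" for u
      using lip[OF t, of u] by (cases "u \<in> ball 0 1") auto
  next
    show "AE u in lborel. ((\<lambda>s. indicator (ball 0 1) u * h (a + s *\<^sub>R u)) has_real_derivative
        indicator (ball 0 1) u * (\<Sum>i\<in>Basis. (u \<bullet> i) * p i (a + r *\<^sub>R u))) (at r)"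
      using dl[OF r] by (auto simp: indicator_def)
    show "(\<lambda>u. indicator (ball 0 1) u * (\<Sum>i\<in>Basis. (u \<bullet> i) * p i (a + r *\<^sub>R u))) \<in> borel_measurable lborel"
      using intp by (auto simp: set_integrable_def dest: borel_measurable_integrable)
  qed (use r in auto)
  then show ?thesis by (simp add: set_lebesgue_integral_def)
qed

text \<open>
  Here \<open>p i\<close> and \<open>q i\<close> are the first and the pure second partial derivatives of \<open>h\<close>.
  In terms of averages, the right-hand side is \<open>2 n w r ^ n\<close> times the sphere average minus the ball
  average, where \<open>w\<close> is the volume of the unit ball. To see it, let \<open>\<phi> r\<close> be the integral of
  \<open>h\<close> over the ball, rescaled to the unit ball. Differentiating \<open>r ^ n * \<phi> r\<close> once as a ball
  integral and once by the product rule expresses the difference of the averages by \<open>\<phi>' r\<close>. On the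
  other hand \<open>\<phi>' r\<close> is the integral of the radial derivative of \<open>h\<close>, and integration by parts
  against the weight \<open>r\<^sup>2 - |x - a|\<^sup>2\<close>, whose gradient is \<open>-2 (x - a)\<close>, turns that
  into the weighted integral of the Laplacian.
\<close>

lemma laplacian_ball_sphere_identity:
  fixes h :: "'a::euclidean_space \<Rightarrow> real"
  assumes dh: "\<And>x. x \<in> cball a R \<Longrightarrow> (h has_derivative (\<lambda>v. \<Sum>i\<in>Basis. (v \<bullet> i) * p i x)) (at x)"
    and p: "\<And>i. i \<in> Basis \<Longrightarrow> continuous_on (cball a R) (p i)"
    and dp: "\<And>i x. i \<in> Basis \<Longrightarrow> x \<in> cball a R \<Longrightarrow>
      ((\<lambda>t. p i (x + t *\<^sub>R i)) has_real_derivative q i x) (at 0)"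
    and q: "\<And>i. i \<in> Basis \<Longrightarrow> continuous_on (cball a R) (q i)"
    and r: "0 < r" "r < R"
  shows "(LINT x:ball a r|lborel. (r\<^sup>2 - (norm (x - a))\<^sup>2) * (\<Sum>i\<in>Basis. q i x)) =
    2 * real DIM('a) * (r ^ DIM('a) * spherical_integral h a r - (LINT x:ball a r|lborel. h x))"
proof -
  let ?n = "DIM('a)"
  have h: "continuous_on (cball a R) h"
    using dh by (meson continuous_at_imp_continuous_on has_derivative_continuous)
  define \<phi> where "\<phi> s = (LINT u:ball 0 1|lborel. h (a + s *\<^sub>R u))" for s
  define d where "d = (LINT u:ball 0 1|lborel. \<Sum>i\<in>Basis. (u \<bullet> i) * p i (a + r *\<^sub>R u))"
  let ?I = "\<lambda>s. LINT x:ball a s|lborel. h x"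
  have I: "?I s = s ^ ?n * \<phi> s" if "0 < s" "s < R" for s
    unfolding \<phi>_def using that by (intro set_integral_ball_scale set_integrable_ball[OF h]) auto
  have "\<forall>\<^sub>F s in nhds r. s \<in> {0<..<R}"
    using r by (intro eventually_nhds_in_open) auto
  then have ev: "\<forall>\<^sub>F s in nhds r. ?I s = s ^ ?n * \<phi> s"
    by eventually_elim (use I in auto)
  have "(\<phi> has_real_derivative d) (at r)"
    unfolding \<phi>_def d_def by (rule has_real_derivative_integral_dilation[OF dh p r])
  from DERIV_mult[OF DERIV_pow[of ?n r] this]
  have "(?I has_real_derivative (real ?n * r ^ (?n - 1) * \<phi> r + d * r ^ ?n)) (at r)"
    using ev by (subst DERIV_cong_ev[OF refl _ refl]) (auto simp: mult_ac)
  from DERIV_unique[OF this has_real_derivative_integral_ball[OF h r]]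
  \<comment> \<open>Comparison of the two derivatives of the ball integral.\<close>
  have e1: "d * r ^ ?n = real ?n * r ^ (?n - 1) * (spherical_integral h a r - \<phi> r)"
    by (simp add: right_diff_distrib)
  have rn: "r ^ ?n = r * r ^ (?n - 1)"
    by (metis DIM_positive power_eq_if not_gr_zero)
  have cG: "continuous_on (cball a R) (\<lambda>x. \<Sum>i\<in>Basis. ((x - a) \<bullet> i) * p i x)"
    by (intro continuous_intros p)
  have sub: "cball a r \<subseteq> cball a R" "ball a r \<subseteq> cball a R" using r by auto
  have "(LINT x:ball a r|lborel. (r\<^sup>2 - (norm (x - a))\<^sup>2) * (\<Sum>i\<in>Basis. q i x)) =
      (\<Sum>i\<in>Basis. LINT x:ball a r|lborel. (r\<^sup>2 - (norm (x - a))\<^sup>2) * q i x)"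
    unfolding sum_distrib_left
    by (intro set_lebesgue_integral_sum set_integrable_ball[of a R]) (use r in \<open>auto intro!: continuous_intros q\<close>)
  also have "\<dots> = (\<Sum>i\<in>Basis. 2 * (LINT x:ball a r|lborel. ((x - a) \<bullet> i) * p i x))"
    by (intro sum.cong refl integral_by_parts_ball r continuous_on_subset[OF p sub(1)]
        continuous_on_subset[OF q sub(1)] dp) (use sub in auto)
  also have "\<dots> = 2 * (LINT x:ball a r|lborel. \<Sum>i\<in>Basis. ((x - a) \<bullet> i) * p i x)"
    unfolding sum_distrib_left[symmetric]
    by (subst set_lebesgue_integral_sum) (use r in \<open>auto intro!: continuous_intros p set_integrable_ball[of a R]\<close>)
  also have "(LINT x:ball a r|lborel. \<Sum>i\<in>Basis. ((x - a) \<bullet> i) * p i x) =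
      r ^ ?n * (LINT u:ball 0 1|lborel. r * (\<Sum>i\<in>Basis. (u \<bullet> i) * p i (a + r *\<^sub>R u)))"
    using r by (subst set_integral_ball_scale[OF r(1) set_integrable_ball[OF cG]]) (auto simp: sum_distrib_left mult_ac)
  also have "\<dots> = r * (d * r ^ ?n)" by (simp add: d_def)
  finally show ?thesis
    unfolding e1 I[OF r] by (simp add: rn algebra_simps)
qed

lemma cball_enlarge:
  fixes a :: "'a::euclidean_space"
  assumes "open S" "cball a r \<subseteq> S" "0 \<le> r"
  obtains R where "r < R" "cball a R \<subseteq> S"
proof -
  obtain \<epsilon> where \<epsilon>: "\<epsilon> > 0" "(\<Union>x\<in>cball a r. cball x \<epsilon>) \<subseteq> S"
    using compact_subset_open_imp_cball_epsilon_subset[OF compact_cball assms(1,2)] by blast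
  have "cball a (r + \<epsilon>) \<subseteq> S"
  proof
    fix z assume "z \<in> cball a (r + \<epsilon>)"
    then have z: "norm (z - a) \<le> r + \<epsilon>" by (simp add: dist_norm norm_minus_commute)
    obtain x where "x \<in> cball a r" "z \<in> cball x \<epsilon>"
    proof (cases "norm (z - a) \<le> r")
      case True
      then show ?thesis using that[of z] \<epsilon>(1) by (simp add: dist_norm norm_minus_commute)
    next
      case False
      then have za: "z \<noteq> a" using assms(3) by auto
      then have "z - (a + r *\<^sub>R sgn (z - a)) = (norm (z - a) - r) *\<^sub>R sgn (z - a)"
        by (simp add: sgn_div_norm algebra_simps)
      then have "norm (z - (a + r *\<^sub>R sgn (z - a))) = norm (z - a) - r"
        using za False by (simp add: norm_sgn)
      then show ?thesis
        using that[of "a + r *\<^sub>R sgn (z - a)"] za assms(3) z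
        by (simp add: dist_norm norm_sgn norm_minus_commute)
    qed
    then show "z \<in> S" using \<epsilon>(2) by blast
  qed
  then show ?thesis using that[of "r + \<epsilon>"] \<epsilon>(1) by simp
qed

lemma integral_laplacian_ball:
  fixes h :: "'a::euclidean_space \<Rightarrow> real"
  assumes "open S" "C2_on S h" "0 < r" "cball a r \<subseteq> S"
  shows "(LINT x:ball a r|lborel. (r\<^sup>2 - (norm (x - a))\<^sup>2) * laplacian h x) =
    2 * real DIM('a) * (r ^ DIM('a) * spherical_integral h a r - (LINT x:ball a r|lborel. h x))"
proof -
  obtain R where R: "r < R" "cball a R \<subseteq> S"
    using cball_enlarge[OF assms(1,4)] assms(3) by auto
  have "C2_on (cball a R) h" by (rule C2_on_subset[OF assms(2) R(2)])
  then show ?thesis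
    unfolding laplacian_def C2_on_def C1_on_def
    by (intro laplacian_ball_sphere_identity[where R = R and p = "partial_deriv h"]
        differentiable_has_derivative_partials differentiable_directional_derivative assms(3) R(1)) auto
qed

section \<open>The mean value property\<close>

text \<open>
  After subtracting \<open>h a\<close>, the hypothesis says that the ball integral \<open>I\<close> satisfies
  \<open>s * I' s = n * I s\<close>. Hence \<open>I s / s ^ n\<close> is constant in \<open>s\<close>. It tends to \<open>0\<close> as
  \<open>s\<close> tends to \<open>0\<close>, because the integrand is continuous and vanishes at \<open>a\<close>; so it is
  \<open>0\<close>. This is where the common value of the averages turns out not to depend on the radius.
\<close>

lemma spherical_integral_eq_center:
  fixes h :: "'a::euclidean_space \<Rightarrow> real"
  assumes h: "continuous_on (cball a R) h"
    and eq: "\<And>s. 0 < s \<Longrightarrow> s < R \<Longrightarrow>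
      (LINT x:ball a s|lborel. h x) = s ^ DIM('a) * spherical_integral h a s"
    and r: "0 < r" "r < R"
  shows "spherical_integral h a r = unit_ball_vol (real DIM('a)) * h a"
proof -
  let ?n = "DIM('a)"
  define w where "w = unit_ball_vol (real ?n)"
  define f where "f x = h x - h a" for x
  define I where "I s = (LINT x:ball a s|lborel. f x)" for s
  have w: "w > 0" by (simp add: w_def)
  have f: "continuous_on (cball a R) f" unfolding f_def by (intro continuous_intros h)
  have Wf: "spherical_integral f a s = spherical_integral h a s - w * h a" if "0 < s" "s < R" for s
    unfolding f_def[abs_def] w_def
    by (intro spherical_integral_diff_const continuous_on_subset[OF h]) (use that in auto)
  have If: "I s = s ^ ?n * spherical_integral f a s" if "0 < s" "s < R" for s
  proof -
    have "I s = (LINT x:ball a s|lborel. h x) - (LINT x:ball a s|lborel. h a)"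
      unfolding I_def f_def using that
      by (intro set_integral_diff set_integrable_ball[of a R] h) auto
    also have "(LINT x:ball a s|lborel. h a) = h a * (w * s ^ ?n)"
      unfolding w_def using that by (intro integral_ball_const) auto
    finally show ?thesis unfolding eq[OF that] Wf[OF that] by (simp add: algebra_simps)
  qed
  have dI: "(I has_real_derivative real ?n * s ^ (?n - 1) * spherical_integral f a s) (at s)"
    if "0 < s" "s < R" for s
    unfolding I_def by (rule has_real_derivative_integral_ball[OF f that])
  have "((\<lambda>s. I s / s ^ ?n) has_real_derivative 0) (at s)" if "0 < s" "s < R" for s
  proof -
    have "((\<lambda>s. I s / s ^ ?n) has_real_derivative
      (real ?n * s ^ (?n - 1) * spherical_integral f a s * s ^ ?n - I s * (real ?n * s ^ (?n - 1)))
        / (s ^ ?n * s ^ ?n)) (at s)"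
      using that by (intro DERIV_divide dI) (auto intro!: derivative_eq_intros)
    then show ?thesis unfolding If[OF that] by (simp add: mult_ac)
  qed
  then have "\<exists>c. \<forall>s\<in>{0<..<R}. I s / s ^ ?n = c"
    by (intro has_field_derivative_zero_constant) (auto intro: has_field_derivative_at_within)
  then obtain c where c: "\<And>s. 0 < s \<Longrightarrow> s < R \<Longrightarrow> I s / s ^ ?n = c" by auto
  have "\<bar>c\<bar> \<le> 0 + e" if e: "0 < e" for e
  proof -
    from f have "\<exists>d>0. \<forall>x\<in>cball a R. dist x a < d \<longrightarrow> dist (f x) (f a) < e / w"
      using r e w unfolding continuous_on_iff by auto
    then obtain d where d: "d > 0" "\<And>x. x \<in> cball a R \<Longrightarrow> dist x a < d \<Longrightarrow> \<bar>f x\<bar> < e / w"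
      by (auto simp: f_def dist_real_def)
    define s where "s = min d R / 2"
    have s: "0 < s" "s < R" "s < d" using d(1) r by (auto simp: s_def min_def)
    have "\<bar>I s\<bar> \<le> e / w * (w * s ^ ?n)"
      unfolding I_def w_def
    proof (rule integral_ball_bound[OF f])
      fix x assume "x \<in> ball a s"
      then have "x \<in> cball a R" "dist x a < d" using s by (auto simp: dist_commute)
      from d(2)[OF this] show "\<bar>f x\<bar> \<le> e / unit_ball_vol (real ?n)" by (simp add: w_def)
    qed (use s in auto)
    then show ?thesis using c[OF s(1,2)] s(1) w by (auto simp: abs_divide pos_divide_le_eq)
  qed
  then have "c = 0" using field_le_epsilon[of "\<bar>c\<bar>" 0] by simp
  then have "I r = 0" using c[OF r] r by simp
  then have "spherical_integral f a r = 0" using If[OF r] r by simp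
  then show ?thesis using Wf[OF r] by (simp add: w_def)
qed

text \<open>
  On each sphere about \<open>a\<close> the weight is constant, so the weighted function
  \<open>g (|x - a|) * (h x - h a)\<close> has vanishing spherical integrals. Hence its ball integrals are
  constant in the radius, and they tend to \<open>0\<close> as the ball shrinks.
\<close>

lemma integral_radial_weight:
  fixes h :: "'a::euclidean_space \<Rightarrow> real" and g :: "real \<Rightarrow> real"
  assumes h: "continuous_on (cball a R) h" and g: "continuous_on UNIV g"
    and mv: "\<And>s. 0 < s \<Longrightarrow> s < R \<Longrightarrow> spherical_integral h a s = unit_ball_vol (real DIM('a)) * h a"
    and r: "0 < r" "r < R"
  shows "(LINT x:ball a r|lborel. g (norm (x - a)) * h x) =
    h a * (LINT x:ball a r|lborel. g (norm (x - a)))"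
proof -
  let ?n = "DIM('a)"
  define w where "w = unit_ball_vol (real ?n)"
  define f where "f x = g (norm (x - a)) * (h x - h a)" for x
  define I where "I s = (LINT x:ball a s|lborel. f x)" for s
  have gn: "continuous_on A (\<lambda>x. g (norm (x - a)))" for A
    by (rule continuous_on_compose2[OF g]) (auto intro!: continuous_intros)
  have f: "continuous_on (cball a R) f" unfolding f_def by (intro continuous_intros h gn)
  have Wf: "spherical_integral f a s = 0" if "0 < s" "s < R" for s
  proof -
    \<comment> \<open>This also holds at \<open>u = 0\<close>, where \<open>sgn u = 0\<close> and both sides vanish.\<close>
    have "f (a + s *\<^sub>R sgn u) = g s * (h (a + s *\<^sub>R sgn u) - h a)" for u
      using that by (cases "u = 0") (auto simp: f_def norm_sgn)
    then have "spherical_integral f a s = g s * spherical_integral (\<lambda>x. h x - h a) a s"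
      unfolding spherical_integral_def by simp
    also have "spherical_integral (\<lambda>x. h x - h a) a s = spherical_integral h a s - unit_ball_vol (real ?n) * h a"
      by (intro spherical_integral_diff_const continuous_on_subset[OF h]) (use that in auto)
    finally show ?thesis using mv[OF that] by simp
  qed
  have "(I has_real_derivative 0) (at s)" if "0 < s" "s < R" for s
    using has_real_derivative_integral_ball[OF f that] Wf[OF that] by (simp add: I_def[abs_def])
  then have "\<exists>c. \<forall>s\<in>{0<..<R}. I s = c"
    by (intro has_field_derivative_zero_constant) (auto intro: has_field_derivative_at_within)
  then obtain c where c: "\<And>s. 0 < s \<Longrightarrow> s < R \<Longrightarrow> I s = c" by auto
  obtain M where M: "0 \<le> M" "\<And>x. x \<in> cball a R \<Longrightarrow> \<bar>f x\<bar> \<le> M"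
    using continuous_on_cball_bounded[OF f] by blast
  have "\<forall>\<^sub>F s in at_right 0. \<bar>c\<bar> \<le> M * (w * s ^ ?n)"
  proof -
    have "\<forall>\<^sub>F s in at_right 0. s \<in> {0<..<R}"
      using r by (intro eventually_at_rightI[of 0 R]) auto
    then show ?thesis
    proof eventually_elim
      case (elim s)
      then have "\<bar>I s\<bar> \<le> M * (w * s ^ ?n)"
        unfolding I_def w_def by (intro integral_ball_bound[OF f] M) auto
      then show ?case using c[of s] elim by simp
    qed
  qed
  moreover have "((\<lambda>s. M * (w * s ^ ?n)) \<longlongrightarrow> M * (w * 0 ^ ?n)) (at_right 0)"
    by (intro tendsto_intros)
  ultimately have "\<bar>c\<bar> \<le> M * (w * 0 ^ ?n)"
    by (intro tendsto_lowerbound) auto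
  then have "I r = 0" using c[OF r] by (simp add: zero_power)
  also have "I r = (LINT x:ball a r|lborel. g (norm (x - a)) * h x) -
      (LINT x:ball a r|lborel. g (norm (x - a)) * h a)"
    unfolding I_def f_def right_diff_distrib using r
    by (intro set_integral_diff set_integrable_ball[of a R] continuous_intros h gn) auto
  finally show ?thesis by (simp add: mult.commute)
qed

section \<open>Smoothing with a radial kernel\<close>

lemma partial_deriv_eqI:
  assumes "(f has_derivative f') (at x)"
  shows "partial_deriv f i x = f' i"
  using frechet_derivative_at[OF assms] by (simp add: partial_deriv_def)

lemma partial_deriv_cong_open:
  assumes "open S" "x \<in> S" "\<And>y. y \<in> S \<Longrightarrow> f y = g y" "g differentiable (at x)"
  shows "partial_deriv f i x = partial_deriv g i x"
  unfolding partial_deriv_def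
  using frechet_derivative_transform_within_open[OF assms(4) assms(1,2), of f] assms(3) by simp

lemma C1_on_cong_open:
  assumes "open S" "\<And>y. y \<in> S \<Longrightarrow> f y = g y" "C1_on S g"
  shows "C1_on S f"
  unfolding C1_on_def
proof (intro conjI ballI)
  fix x assume x: "x \<in> S"
  then have "g differentiable (at x)" using assms(3) by (simp add: C1_on_def)
  then show "f differentiable (at x)"
    unfolding differentiable_def
    using has_derivative_transform_within_open[OF _ assms(1) x, of g _ UNIV f] assms(2) by metis
next
  fix i :: 'a assume "i \<in> Basis"
  then have "continuous_on S (partial_deriv g i)" using assms(3) by (simp add: C1_on_def)
  moreover have "partial_deriv f i x = partial_deriv g i x" if "x \<in> S" for x
    using that assms by (intro partial_deriv_cong_open) (auto simp: C1_on_def)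
  ultimately show "continuous_on S (partial_deriv f i)"
    by (simp cong: continuous_on_cong)
qed

lemma C2_on_cong_open:
  assumes "open S" "\<And>y. y \<in> S \<Longrightarrow> f y = g y" "C2_on S g"
  shows "C2_on S f"
  unfolding C2_on_def
proof (intro conjI ballI)
  show "C1_on S f" using assms by (intro C1_on_cong_open[of S f g]) (auto simp: C2_on_def)
  fix i :: 'a assume i: "i \<in> Basis"
  show "C1_on S (partial_deriv f i)"
  proof (rule C1_on_cong_open[OF assms(1)])
    show "C1_on S (partial_deriv g i)" using assms(3) i by (simp add: C2_on_def)
    show "partial_deriv f i y = partial_deriv g i y" if "y \<in> S" for y
      using that assms by (intro partial_deriv_cong_open) (auto simp: C2_on_def C1_on_def)
  qed
qed

lemma C1_on_local:
  assumes "\<And>x. x \<in> S \<Longrightarrow> \<exists>U. open U \<and> x \<in> U \<and> C1_on U f"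
  shows "C1_on S f"
  unfolding C1_on_def
proof (intro conjI ballI)
  fix x assume "x \<in> S"
  then show "f differentiable (at x)" using assms by (auto simp: C1_on_def)
next
  fix i :: 'a assume i: "i \<in> Basis"
  show "continuous_on S (partial_deriv f i)"
  proof (rule continuous_at_imp_continuous_on, rule ballI)
    fix x assume "x \<in> S"
    then obtain U where "open U" "x \<in> U" "C1_on U f" using assms by blast
    then show "isCont (partial_deriv f i) x"
      using i by (auto simp: C1_on_def continuous_on_eq_continuous_at)
  qed
qed

lemma C2_on_local:
  assumes "\<And>x. x \<in> S \<Longrightarrow> \<exists>U. open U \<and> x \<in> U \<and> C2_on U f"
  shows "C2_on S f"
  unfolding C2_on_def
proof (intro conjI ballI)
  show "C1_on S f" by (rule C1_on_local) (use assms in \<open>auto simp: C2_on_def\<close>)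
  show "C1_on S (partial_deriv f i)" if "i \<in> Basis" for i
    by (rule C1_on_local) (use assms that in \<open>force simp: C2_on_def\<close>)
qed

text \<open>
  All derivatives fall on the kernel, so \<open>h\<close> need only be continuous. The integral is taken over a
  fixed box, on which \<open>h\<close> is continuous, rather than over a support that moves with \<open>z\<close>.
\<close>

lemma convolution_C1:
  fixes K :: "'a::euclidean_space \<Rightarrow> real" and h :: "'a \<Rightarrow> real"
  assumes dK: "\<And>x. (K has_derivative (\<lambda>v. \<Sum>i\<in>Basis. (v \<bullet> i) * K' i x)) (at x)"
    and K': "\<And>i. i \<in> Basis \<Longrightarrow> continuous_on UNIV (K' i)"
    and h: "continuous_on (cbox c d) h"
  defines "F \<equiv> \<lambda>z. integral (cbox c d) (\<lambda>y. K (y - z) * h y)"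
  shows "C1_on UNIV F"
    and "i \<in> Basis \<Longrightarrow> partial_deriv F i = (\<lambda>z. integral (cbox c d) (\<lambda>y. - K' i (y - z) * h y))"
proof -
  define fx where "fx z y = (\<Sum>i\<in>Basis. (- K' i (y - z) * h y) *\<^sub>R blinfun_inner_left i)" for z y :: 'a
  have fx: "blinfun_apply (fx z y) v = (\<Sum>i\<in>Basis. (v \<bullet> i) * (- K' i (y - z) * h y))" for z y v
    by (simp add: fx_def blinfun.sum_left blinfun.scaleR_left blinfun.minus_left mult_ac)
  have K: "continuous_on UNIV K"
    using dK by (meson continuous_at_imp_continuous_on has_derivative_continuous)
  have cK': "continuous_on (A \<times> cbox c d) (\<lambda>(z, y). - K' i (y - z) * h y)" if "i \<in> Basis" for i A
    unfolding split_beta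
    by (intro continuous_intros continuous_on_compose2[OF K'[OF that]] continuous_on_compose2[OF h]) auto
  have cont: "continuous_on (UNIV \<times> cbox c d) (\<lambda>(z, y). fx z y)"
    unfolding fx_def split_beta
    by (intro continuous_on_sum continuous_on_scaleR continuous_on_const cK'[unfolded split_beta])
  have d: "((\<lambda>z. K (y - z) * h y) has_derivative blinfun_apply (fx z y)) (at z)" for z y
  proof -
    have "((\<lambda>z. y - z) has_derivative (\<lambda>v. - v)) (at z)"
      by (auto intro!: derivative_eq_intros)
    from has_derivative_mult_left[OF has_derivative_compose[OF this dK], of "h y"]
    show ?thesis
      by (rule has_derivative_eq_rhs) (simp add: fun_eq_iff fx sum_distrib_left sum_distrib_right mult_ac)
  qed
  have D: "(F has_derivative blinfun_apply (integral (cbox c d) (fx z))) (at z)" for z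
    unfolding F_def
    by (rule leibniz_rule[where U = UNIV])
      (use d cont in \<open>auto intro!: integrable_continuous continuous_intros continuous_on_compose2[OF K] h\<close>)
  have P: "partial_deriv F i = (\<lambda>z. integral (cbox c d) (\<lambda>y. - K' i (y - z) * h y))" if i: "i \<in> Basis" for i
  proof
    fix z
    have "fx z integrable_on cbox c d"
      by (intro integrable_continuous continuous_on_compose2[OF cont, of _ "\<lambda>y. (z, y)", simplified])
        (auto intro!: continuous_intros)
    then have "partial_deriv F i z = integral (cbox c d) (\<lambda>y. blinfun_apply (fx z y) i)"
      by (simp add: partial_deriv_eqI[OF D] blinfun_apply_integral)
    also have "(\<lambda>y. blinfun_apply (fx z y) i) = (\<lambda>y. - K' i (y - z) * h y)"
      using i by (simp add: fx fun_eq_iff inner_Basis if_distrib if_distribR cong: if_cong)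
    finally show "partial_deriv F i z = integral (cbox c d) (\<lambda>y. - K' i (y - z) * h y)" .
  qed
  then show "i \<in> Basis \<Longrightarrow> partial_deriv F i = (\<lambda>z. integral (cbox c d) (\<lambda>y. - K' i (y - z) * h y))" .
  show "C1_on UNIV F"
    unfolding C1_on_def
  proof (intro conjI ballI)
    show "F differentiable (at z)" for z using D[of z] by (auto simp: differentiable_def)
    show "continuous_on UNIV (partial_deriv F i)" if "i \<in> Basis" for i
      unfolding P[OF that] by (rule integral_continuous_on_param[OF cK'[OF that]])
  qed
qed

lemma convolution_C2:
  fixes K :: "'a::euclidean_space \<Rightarrow> real" and h :: "'a \<Rightarrow> real"
  assumes dK: "\<And>x. (K has_derivative (\<lambda>v. \<Sum>i\<in>Basis. (v \<bullet> i) * K' i x)) (at x)"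
    and dK': "\<And>i x. i \<in> Basis \<Longrightarrow> (K' i has_derivative (\<lambda>v. \<Sum>j\<in>Basis. (v \<bullet> j) * K'' i j x)) (at x)"
    and K'': "\<And>i j. i \<in> Basis \<Longrightarrow> j \<in> Basis \<Longrightarrow> continuous_on UNIV (K'' i j)"
    and h: "continuous_on (cbox c d) h"
  shows "C2_on UNIV (\<lambda>z. integral (cbox c d) (\<lambda>y. K (y - z) * h y))"
  unfolding C2_on_def
proof (intro conjI ballI)
  have K': "continuous_on UNIV (K' i)" if "i \<in> Basis" for i
    using dK'[OF that] by (meson continuous_at_imp_continuous_on has_derivative_continuous)
  show "C1_on UNIV (\<lambda>z. integral (cbox c d) (\<lambda>y. K (y - z) * h y))"
    by (rule convolution_C1(1)[OF dK K' h])
  fix i :: 'a assume i: "i \<in> Basis"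
  have "((\<lambda>x. - K' i x) has_derivative (\<lambda>v. \<Sum>j\<in>Basis. (v \<bullet> j) * - K'' i j x)) (at x)" for x
    using has_derivative_minus[OF dK'[OF i]] by (simp add: sum_negf)
  from convolution_C1(1)[OF this _ h] K''[OF i]
  have "C1_on UNIV (\<lambda>z. integral (cbox c d) (\<lambda>y. - K' i (y - z) * h y))"
    by (auto intro: continuous_intros)
  then show "C1_on UNIV (partial_deriv (\<lambda>z. integral (cbox c d) (\<lambda>y. K (y - z) * h y)) i)"
    by (simp only: convolution_C1(2)[OF dK K' h i])
qed

lemma has_real_derivative_pos_part_power:
  fixes t :: real
  assumes "2 \<le> n"
  shows "((\<lambda>t. max 0 t ^ n) has_real_derivative real n * max 0 t ^ (n - 1)) (at t)"
proof -
  consider "0 < t" | "t < 0" | "t = 0" by linarith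
  then show ?thesis
  proof cases
    case 1
    then have "\<forall>\<^sub>F s in nhds t. s \<in> {0<..}" by (intro eventually_nhds_in_open) auto
    then have "\<forall>\<^sub>F s in nhds t. max 0 s ^ n = s ^ n" by eventually_elim auto
    then show ?thesis
      using DERIV_pow[of n t] 1 by (subst DERIV_cong_ev[OF refl _ refl]) auto
  next
    case 2
    then have "\<forall>\<^sub>F s in nhds t. s \<in> {..<0}" by (intro eventually_nhds_in_open) auto
    then have "\<forall>\<^sub>F s in nhds t. max 0 s ^ n = 0"
      by eventually_elim (use assms in \<open>auto simp: zero_power\<close>)
    from iffD2[OF DERIV_cong_ev[OF refl this refl] DERIV_const[of 0]] show ?thesis
      using 2 assms by (simp add: zero_power)
  next
    case 3
    have eq: "(max 0 s ^ n - max 0 0 ^ n) / (s - 0) = max 0 s ^ (n - 1)" if "s \<noteq> 0" for s :: real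
      using that assms by (cases n) (auto simp: max_def zero_power)
    have "((\<lambda>s::real. max 0 s ^ (n - 1)) \<longlongrightarrow> max 0 0 ^ (n - 1)) (at 0)"
      by (intro tendsto_intros)
    then have "((\<lambda>s::real. (max 0 s ^ n - max 0 0 ^ n) / (s - 0)) \<longlongrightarrow> max 0 0 ^ (n - 1)) (at 0)"
      by (rule Lim_transform_eventually, unfold eventually_at_filter,
          intro always_eventually allI impI eq[symmetric])
    then show ?thesis
      using 3 assms by (simp add: has_field_derivative_iff zero_power)
  qed
qed

text \<open>
  These radial functions, supported in a ball of radius \<open>\<rho>\<close>, serve as smoothing kernels. Each
  derivative costs one power of the factor that vanishes at the boundary of the support: the exponent
  \<open>3\<close> is the smallest one that makes the kernel twice continuously differentiable.
\<close>

lemma has_derivative_bump_power: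
  fixes x :: "'a::euclidean_space"
  assumes "2 \<le> n"
  shows "((\<lambda>x. max 0 (\<rho>\<^sup>2 - x \<bullet> x) ^ n) has_derivative
    (\<lambda>v. \<Sum>i\<in>Basis. (v \<bullet> i) * (- 2 * real n * (x \<bullet> i) * max 0 (\<rho>\<^sup>2 - x \<bullet> x) ^ (n - 1)))) (at x)"
proof -
  have "((\<lambda>x. \<rho>\<^sup>2 - x \<bullet> x) has_derivative (\<lambda>v. - 2 * (v \<bullet> x))) (at x)"
    by (auto intro!: derivative_eq_intros simp: inner_commute)
  from has_derivative_compose[OF this has_real_derivative_pos_part_power[OF assms, of "\<rho>\<^sup>2 - x \<bullet> x",
      unfolded has_field_derivative_def]]
  show ?thesis
  proof (rule has_derivative_eq_rhs)
    show "(\<lambda>v. real n * max 0 (\<rho>\<^sup>2 - x \<bullet> x) ^ (n - 1) * (- 2 * (v \<bullet> x))) =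
      (\<lambda>v. \<Sum>i\<in>Basis. (v \<bullet> i) * (- 2 * real n * (x \<bullet> i) * max 0 (\<rho>\<^sup>2 - x \<bullet> x) ^ (n - 1)))"
    proof
      fix v :: 'a
      show "real n * max 0 (\<rho>\<^sup>2 - x \<bullet> x) ^ (n - 1) * (- 2 * (v \<bullet> x)) =
        (\<Sum>i\<in>Basis. (v \<bullet> i) * (- 2 * real n * (x \<bullet> i) * max 0 (\<rho>\<^sup>2 - x \<bullet> x) ^ (n - 1)))"
        by (subst euclidean_inner[of v x]) (simp add: sum_distrib_left sum_distrib_right mult_ac)
    qed
  qed
qed

lemma convolution_bump_C2:
  fixes h :: "'a::euclidean_space \<Rightarrow> real"
  assumes "continuous_on (cbox c d) h"
  shows "C2_on UNIV (\<lambda>z. integral (cbox c d) (\<lambda>y. max 0 (\<rho>\<^sup>2 - (y - z) \<bullet> (y - z)) ^ 3 * h y))"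
proof (rule convolution_C2[OF _ _ _ assms])
  let ?m = "\<lambda>x::'a. max 0 (\<rho>\<^sup>2 - x \<bullet> x)"
  show "((\<lambda>x. ?m x ^ 3) has_derivative (\<lambda>v. \<Sum>i\<in>Basis. (v \<bullet> i) * (- 6 * (x \<bullet> i) * ?m x ^ 2))) (at x)" for x
    using has_derivative_bump_power[of 3 \<rho> x] by simp
  fix i x :: 'a assume i: "i \<in> Basis"
  have "((\<lambda>x. ?m x ^ 2) has_derivative (\<lambda>v. \<Sum>j\<in>Basis. (v \<bullet> j) * (- 4 * (x \<bullet> j) * ?m x))) (at x)"
    using has_derivative_bump_power[of 2 \<rho> x] by simp
  moreover have "((\<lambda>x. - 6 * (x \<bullet> i)) has_derivative (\<lambda>v. - 6 * (v \<bullet> i))) (at x)"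
    by (auto intro!: derivative_eq_intros)
  ultimately have "((\<lambda>x. - 6 * (x \<bullet> i) * ?m x ^ 2) has_derivative
      (\<lambda>v. - 6 * (x \<bullet> i) * (\<Sum>j\<in>Basis. (v \<bullet> j) * (- 4 * (x \<bullet> j) * ?m x)) + - 6 * (v \<bullet> i) * ?m x ^ 2)) (at x)"
    by (rule has_derivative_mult[rotated])
  then show "((\<lambda>x. - 6 * (x \<bullet> i) * ?m x ^ 2) has_derivative
      (\<lambda>v. \<Sum>j\<in>Basis. (v \<bullet> j) * (24 * (x \<bullet> i) * (x \<bullet> j) * ?m x - (if j = i then 6 * ?m x ^ 2 else 0)))) (at x)"
  proof (rule has_derivative_eq_rhs)
    have "(\<Sum>j\<in>Basis. (v \<bullet> j) * (if j = i then 6 * ?m x ^ 2 else 0)) = (v \<bullet> i) * (6 * ?m x ^ 2)" for v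
      using i by (simp add: if_distrib cong: if_cong)
    then show "(\<lambda>v. - 6 * (x \<bullet> i) * (\<Sum>j\<in>Basis. (v \<bullet> j) * (- 4 * (x \<bullet> j) * ?m x)) + - 6 * (v \<bullet> i) * ?m x ^ 2) =
      (\<lambda>v. \<Sum>j\<in>Basis. (v \<bullet> j) * (24 * (x \<bullet> i) * (x \<bullet> j) * ?m x - (if j = i then 6 * ?m x ^ 2 else 0)))"
      by (simp only: right_diff_distrib sum_subtractf) (simp add: fun_eq_iff sum_distrib_left mult_ac)
  qed
next
  show "continuous_on UNIV (\<lambda>x. 24 * (x \<bullet> i) * (x \<bullet> j) * max 0 (\<rho>\<^sup>2 - x \<bullet> x) -
      (if j = i then 6 * max 0 (\<rho>\<^sup>2 - x \<bullet> x) ^ 2 else 0))" for i j :: 'a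
    by (cases "j = i") (auto intro!: continuous_intros)
qed

text \<open>
  Near any point, averaging \<open>h\<close> against a radial kernel returns a constant multiple of \<open>h\<close>
  itself, by the mean value property, and the averaged function inherits the smoothness of the kernel.
\<close>

lemma mean_value_imp_C2:
  fixes h :: "'a::euclidean_space \<Rightarrow> real"
  assumes S: "open S" and h: "continuous_on S h"
    and mv: "\<And>a r. 0 < r \<Longrightarrow> cball a r \<subseteq> S \<Longrightarrow>
      spherical_integral h a r = unit_ball_vol (real DIM('a)) * h a"
  shows "C2_on S h"
proof (rule C2_on_local)
  fix a assume a: "a \<in> S"
  obtain c d where cd: "cbox c d \<subseteq> S" "a \<in> box c d"
    using open_contains_cbox[OF S a] by metis
  obtain e where e: "e > 0" "cball a e \<subseteq> box c d"
    using open_contains_cball[of "box c d"] cd(2) open_box by blast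
  \<comment> \<open>The mean value property is needed on radii up to \<open>2 * \<rho>\<close> about every \<open>z\<close> in \<open>ball a \<rho>\<close>.\<close>
  define \<rho> where "\<rho> = e / 3"
  have \<rho>: "\<rho> > 0" using e(1) by (simp add: \<rho>_def)
  define g where "g t = max 0 (\<rho>\<^sup>2 - t\<^sup>2) ^ 3" for t :: real
  have g: "continuous_on UNIV g" unfolding g_def by (intro continuous_intros)
  have gn: "continuous_on A (\<lambda>x. g (norm (x - z)))" for A and z :: 'a
    by (rule continuous_on_compose2[OF g]) (auto intro!: continuous_intros)
  have hc: "continuous_on (cbox c d) h" by (rule continuous_on_subset[OF h cd(1)])
  define C where "C = \<rho> ^ DIM('a) * (LINT u:ball (0::'a) 1|lborel. g (norm (\<rho> *\<^sub>R u)))"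
  have C: "(LINT x:ball z \<rho>|lborel. g (norm (x - z))) = C" for z :: 'a
    using set_integral_ball_scale[OF \<rho> set_integrable_ball[OF gn order_refl], of z z]
    by (simp add: C_def)
  have "0 < C"
    unfolding C[of 0, symmetric]
  proof (rule integral_ball_pos[OF \<rho> gn])
    fix x :: 'a assume "x \<in> ball 0 \<rho>"
    then have "(norm x)\<^sup>2 < \<rho>\<^sup>2" by (intro power_strict_mono) auto
    then show "0 < g (norm (x - 0))" by (simp add: g_def)
  qed
  define F where "F z = integral (cbox c d) (\<lambda>y. max 0 (\<rho>\<^sup>2 - (y - z) \<bullet> (y - z)) ^ 3 * h y)" for z
  have hF: "h z = F z / C" if z: "z \<in> ball a \<rho>" for z
  proof -
    have sub: "cball z (2 * \<rho>) \<subseteq> cbox c d"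
    proof
      fix y assume "y \<in> cball z (2 * \<rho>)"
      then have "dist a y \<le> e" using z dist_triangle[of a y z] by (simp add: \<rho>_def)
      then show "y \<in> cbox c d" using e(2) box_subset_cbox[of c d] by auto
    qed
    have "(LINT x:ball z \<rho>|lborel. g (norm (x - z)) * h x) = h z * C"
      unfolding C[of z, symmetric]
    proof (rule integral_radial_weight[where R = "2 * \<rho>"])
      show "continuous_on (cball z (2 * \<rho>)) h" by (rule continuous_on_subset[OF hc sub])
      show "spherical_integral h z s = unit_ball_vol (real DIM('a)) * h z" if "0 < s" "s < 2 * \<rho>" for s
        by (rule mv) (use that sub cd in \<open>force+\<close>)
    qed (use g \<rho> in auto)
    also have "(LINT x:ball z \<rho>|lborel. g (norm (x - z)) * h x) =
        (LINT x:cbox c d|lborel. g (norm (x - z)) * h x)"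
    proof -
      have "g (norm (x - z)) = 0" if "x \<notin> ball z \<rho>" for x
      proof -
        have "\<rho> \<le> norm (x - z)" using that by (simp add: dist_norm norm_minus_commute)
        then have "\<rho>\<^sup>2 \<le> (norm (x - z))\<^sup>2" using \<rho> by (intro power_mono) auto
        then show ?thesis by (simp add: g_def)
      qed
      moreover have "ball z \<rho> \<subseteq> cbox c d" using sub \<rho> by force
      ultimately have "(\<lambda>x. indicator (ball z \<rho>) x *\<^sub>R (g (norm (x - z)) * h x)) =
          (\<lambda>x. indicator (cbox c d) x *\<^sub>R (g (norm (x - z)) * h x))"
        by (auto simp: fun_eq_iff indicator_def subset_iff simp del: mem_ball)
      then show ?thesis unfolding set_lebesgue_integral_def by simp
    qed
    also have "\<dots> = integral (cbox c d) (\<lambda>x. g (norm (x - z)) * h x)"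
    proof (rule set_borel_integral_eq_integral)
      show "set_integrable lborel (cbox c d) (\<lambda>x. g (norm (x - z)) * h x)"
        unfolding set_integrable_def
        by (intro borel_integrable_compact compact_cbox continuous_intros gn hc)
    qed
    also have "\<dots> = F z" by (simp add: F_def g_def power2_norm_eq_inner)
    finally show ?thesis using \<open>0 < C\<close> by (simp add: field_simps)
  qed
  \<comment> \<open>The constant is put inside the integral, so that the smoothness lemma applies to the quotient.\<close>
  have "C2_on UNIV (\<lambda>z. integral (cbox c d) (\<lambda>y. max 0 (\<rho>\<^sup>2 - (y - z) \<bullet> (y - z)) ^ 3 * (h y / C)))"
    by (rule convolution_bump_C2) (use \<open>0 < C\<close> in \<open>auto intro!: continuous_intros hc\<close>)
  also have "(\<lambda>z. integral (cbox c d) (\<lambda>y. max 0 (\<rho>\<^sup>2 - (y - z) \<bullet> (y - z)) ^ 3 * (h y / C))) = (\<lambda>z. F z / C)"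
    by (simp add: F_def fun_eq_iff)
  finally have "C2_on (ball a \<rho>) (\<lambda>z. F z / C)" by (rule C2_on_subset) simp
  then have "C2_on (ball a \<rho>) h"
    using C2_on_cong_open[OF open_ball, of a \<rho> h "\<lambda>z. F z / C"] hF by blast
  then show "\<exists>U. open U \<and> a \<in> U \<and> C2_on U h" using \<rho> by (intro exI[of _ "ball a \<rho>"]) simp
qed

section \<open>Harmonic functions and equal averages\<close>

lemma continuous_on_laplacian:
  assumes "C2_on S f"
  shows "continuous_on S (laplacian f)"
  using assms unfolding laplacian_def[abs_def] C2_on_def C1_on_def by (intro continuous_intros) auto

text \<open>
  If the Laplacian were nonzero at \<open>a\<close>, it would have constant sign on a small ball, and then so would
  the left-hand side of \<open>integral_laplacian_ball\<close>, while the right-hand side vanishes.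
\<close>

lemma C2_averages_eq_imp_laplacian_zero:
  fixes h :: "'a::euclidean_space \<Rightarrow> real"
  assumes S: "open S" and h: "C2_on S h" and a: "a \<in> S"
    and eq: "\<And>r. 0 < r \<Longrightarrow> cball a r \<subseteq> S \<Longrightarrow>
      (LINT x:ball a r|lborel. h x) = r ^ DIM('a) * spherical_integral h a r"
  shows "laplacian h a = 0"
proof (rule ccontr)
  assume nz: "laplacian h a \<noteq> 0"
  define \<sigma> where "\<sigma> = sgn (laplacian h a)"
  have cL: "continuous_on S (\<lambda>x. \<sigma> * laplacian h x)"
    by (intro continuous_intros continuous_on_laplacian h)
  have "0 < \<sigma> * laplacian h a" using nz by (simp add: \<sigma>_def sgn_if)
  then have "a \<in> {x \<in> S. 0 < \<sigma> * laplacian h x}" using a by simp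
  moreover have "open {x \<in> S. 0 < \<sigma> * laplacian h x}"
    using continuous_openin_preimage_gen[OF cL open_greaterThan[of 0]] S
    by (simp add: openin_open_eq vimage_def Int_def greaterThan_def)
  ultimately obtain r where r: "0 < r" "cball a r \<subseteq> {x \<in> S. 0 < \<sigma> * laplacian h x}"
    unfolding open_contains_cball by blast
  then have sub: "cball a r \<subseteq> S" by auto
  have "0 < (LINT x:ball a r|lborel. (r\<^sup>2 - (norm (x - a))\<^sup>2) * (\<sigma> * laplacian h x))"
  proof (rule integral_ball_pos[OF r(1)])
    show "continuous_on (cball a r) (\<lambda>x. (r\<^sup>2 - (norm (x - a))\<^sup>2) * (\<sigma> * laplacian h x))"
      by (intro continuous_on_mult[OF _ continuous_on_subset[OF cL sub]] continuous_intros)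
    fix x assume x: "x \<in> ball a r"
    then have "(norm (x - a))\<^sup>2 < r\<^sup>2"
      by (intro power_strict_mono) (auto simp: dist_norm norm_minus_commute)
    moreover have "0 < \<sigma> * laplacian h x" using r(2) x by force
    ultimately show "0 < (r\<^sup>2 - (norm (x - a))\<^sup>2) * (\<sigma> * laplacian h x)" by simp
  qed
  also have "\<dots> = \<sigma> * (LINT x:ball a r|lborel. (r\<^sup>2 - (norm (x - a))\<^sup>2) * laplacian h x)"
    by (simp add: mult.left_commute[of _ \<sigma>])
  also have "\<dots> = 0"
    using integral_laplacian_ball[OF S h r(1) sub] eq[OF r(1) sub] by simp
  finally show False by simp
qed

lemma harmonic_on_iff_averages_eq:
  fixes h :: "'a::euclidean_space \<Rightarrow> real"
  assumes S: "open S" and h: "continuous_on S h"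
  shows "harmonic_on S h \<longleftrightarrow>
    (\<forall>a r. 0 < r \<and> cball a r \<subseteq> S \<longrightarrow> ball_average h a r = sphere_average h a r)"
proof -
  have "harmonic_on S h \<longleftrightarrow> (\<forall>a r. 0 < r \<and> cball a r \<subseteq> S \<longrightarrow>
      (LINT x:ball a r|lborel. h x) = r ^ DIM('a) * spherical_integral h a r)" (is "_ \<longleftrightarrow> ?eq")
  proof
    assume H: "harmonic_on S h"
    show ?eq
    proof (intro allI impI, elim conjE)
      fix a r assume r: "0 < r" "cball a r \<subseteq> S"
      have "(LINT x:ball a r|lborel. (r\<^sup>2 - (norm (x - a))\<^sup>2) * laplacian h x) =
          (LINT x:ball a r|lborel. 0)"
        using H r(2) unfolding set_lebesgue_integral_def
        by (intro Bochner_Integration.integral_cong refl) (auto simp: harmonic_on_def indicator_def subset_iff)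
      then show "(LINT x:ball a r|lborel. h x) = r ^ DIM('a) * spherical_integral h a r"
        using integral_laplacian_ball[OF S _ r] H by (simp add: harmonic_on_def)
    qed
  next
    assume E: ?eq
    have "C2_on S h"
    proof (rule mean_value_imp_C2[OF S h])
      fix a r assume r: "0 < r" "cball a r \<subseteq> S"
      obtain R where R: "r < R" "cball a R \<subseteq> S"
        using cball_enlarge[OF S r(2)] r(1) by auto
      show "spherical_integral h a r = unit_ball_vol (real DIM('a)) * h a"
      proof (rule spherical_integral_eq_center[OF continuous_on_subset[OF h R(2)] _ r(1) R(1)])
        fix s assume s: "0 < s" "s < R"
        then have "cball a s \<subseteq> S" using R(2) by force
        then show "(LINT x:ball a s|lborel. h x) = s ^ DIM('a) * spherical_integral h a s"
          using E s by blast
      qed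
    qed
    then show "harmonic_on S h"
      using E C2_averages_eq_imp_laplacian_zero[OF S] by (auto simp: harmonic_on_def)
  qed
  also have "\<dots> \<longleftrightarrow> (\<forall>a r. 0 < r \<and> cball a r \<subseteq> S \<longrightarrow> ball_average h a r = sphere_average h a r)"
    using ball_average_eq_sphere_average_iff continuous_on_subset[OF h] by metis
  finally show ?thesis .
qed

theorem theorem1p1:
  fixes \<Omega> :: "(real ^ 'n) set" and h :: "real ^ 'n \<Rightarrow> real"
  assumes "open \<Omega>" "connected \<Omega>" "\<Omega> \<noteq> {}"
    and "continuous_on \<Omega> h"
  shows "harmonic_on \<Omega> h \<longleftrightarrow>
    (\<forall>a r. 0 < r \<and> closure (ball a r) \<subseteq> \<Omega> \<longrightarrow> ball_average h a r = sphere_average h a r)"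
proof -
  have "(0 < r \<and> closure (ball a r) \<subseteq> \<Omega>) = (0 < r \<and> cball a r \<subseteq> \<Omega>)" for a r
    by (cases "0 < r") auto
  then show ?thesis
    by (simp only: harmonic_on_iff_averages_eq[OF assms(1,4)])
qed

end
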